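(* Let $E$ and $F$ be complex Banach spaces, let $A_m:\mathrm{dom}(A_m)\subseteq E\to E$ and $B:\mathrm{dom}(B)\subseteq F\to F$ be linear operators, and let $L:\mathrm{dom}(A_m)\to F$ be linear, surjective and bounded with respect to the graph norm of $A_m$. Assume that the restriction $A_0$ of $A_m$ to $\ker(L)$ generates a bounded analytic semigroup $(T_0(t))_{t\ge0}$ on $E$, that $B$ generates a strongly continuous semigroup $(S(t))_{t\ge0}$ on $F$, that $x\mapsto(A_mx,Lx)$, $\mathrm{dom}(A_m)\to E\times F$, is closed, and that $A_0$ and $B$ are boundedly invertible. Let $D_0:=(L|_{\ker(A_m)})^{-1}:F\to E$. Assume that for $y\in\mathrm{dom}(B)$ and $t\ge0$ the operators $Q(t)y=D_0S(t)y-T_0(t)D_0y-\int_0^tT_0(t-s)D_0S(s)By\,\mathrm{d}s$ extend to bounded operators $F\to E$ with $\limsup_{t\downarrow0}\|Q(t)\|<\infty$. Let $\gamma\in[0,1]$ be such that the range of $D_0$ is contained in $\mathrm{dom}((-A_0)^\gamma)$. For $\tau>0$ and integers $n\ge1$ define on $\mathrm{dom}(B)$ \[ V^{[\mathrm{Str}]}(\tau)=-\tau T_0(\tfrac\tau2)D_0BS(\tfrac\tau2),\qquad V_n^{[\mathrm{Str}]}(\tau)=\sum_{j=0}^{n-1}T_0((n-1-j)\tau)V^{[\mathrm{Str}]}(\tau)S(j\tau). \] Then for each $t_{\max}>0$ there is $C\ge0$ such that for every integer $n\ge1$, every $y\in\mathrm{dom}(B^3)$ and every $t\in(0,t_{\max}]$,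 \[ \Bigl\|V_n^{[\mathrm{Str}]}(\tfrac tn)y+\int_0^tT_0(t-s)D_0S(s)By\,\mathrm{d}s\Bigr\|\le C\frac{t^{1+\gamma}\log(n)}{n^{1+\gamma}}\bigl(\|By\|+\|B^2y\|+\|B^3y\|\bigr). \]
   Context: $(-A_0)^\gamma$ denotes the fractional power of the sectorial operator $-A_0$. Under the stated assumptions $D_0$ is bounded. $V_n^{[\mathrm{Str}]}(\tfrac tn)$ is the upper right entry of the $n$-th power of the Strang splitting operator $\begin{pmatrix}T_0(\tau)&V^{[\mathrm{Str}]}(\tau)\\0&S(\tau)\end{pmatrix}$, $\tau=t/n$.
   Formalization: The bound is proved for every integer n ≥ 2 instead of n ≥ 1: for n = 1 the factor log(n) vanishes and the claimed estimate would force the one-step splitting to be exact, which is false in general. *)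

theory Defs
  imports "HOL-Analysis.Analysis"
begin

text \<open>A complex Banach space is modelled as a real Banach space together with a
  bounded real-linear map J (multiplication by i) with J (J x) = -x and such that
  multiplication by unimodular complex scalars is isometric (so the norm is a complex norm).\<close>

definition cstruct :: "('a::real_normed_vector \<Rightarrow> 'a) \<Rightarrow> bool" where
  "cstruct J \<longleftrightarrow> bounded_linear J \<and> (\<forall>x. J (J x) = - x) \<and>
     (\<forall>\<theta> x. norm (cos \<theta> *\<^sub>R x + sin \<theta> *\<^sub>R J x) = norm x)"

definition cscale :: "('a::real_vector \<Rightarrow> 'a) \<Rightarrow> complex \<Rightarrow> 'a \<Rightarrow> 'a" where
  "cscale J c x = Re c *\<^sub>R x + Im c *\<^sub>R J x"

definition clin_op :: "('a::real_vector \<Rightarrow> 'a) \<Rightarrow> ('b::real_vector \<Rightarrow> 'b) \<Rightarrow> 'a set \<Rightarrow> ('a \<Rightarrow> 'b) \<Rightarrow> bool" where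
  "clin_op J1 J2 D A \<longleftrightarrow> subspace D \<and> (\<forall>x\<in>D. J1 x \<in> D) \<and>
     (\<forall>x\<in>D. \<forall>y\<in>D. A (x + y) = A x + A y) \<and>
     (\<forall>x\<in>D. \<forall>c. A (c *\<^sub>R x) = c *\<^sub>R A x) \<and>
     (\<forall>x\<in>D. A (J1 x) = J2 (A x))"

definition c0_semigroup :: "(real \<Rightarrow> 'a::real_normed_vector \<Rightarrow> 'a) \<Rightarrow> bool" where
  "c0_semigroup T \<longleftrightarrow> T 0 = id \<and> (\<forall>t\<ge>0. bounded_linear (T t)) \<and>
     (\<forall>t\<ge>0. \<forall>s\<ge>0. T (t + s) = T t \<circ> T s) \<and>
     (\<forall>x. continuous_on {0..} (\<lambda>t. T t x))"

definition generates :: "'a set \<Rightarrow> ('a \<Rightarrow> 'a) \<Rightarrow> (real \<Rightarrow> 'a::real_normed_vector \<Rightarrow> 'a) \<Rightarrow> bool" where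
  "generates D A T \<longleftrightarrow> c0_semigroup T \<and>
     D = {x. \<exists>y. ((\<lambda>h. inverse h *\<^sub>R (T h x - x)) \<longlongrightarrow> y) (at_right 0)} \<and>
     (\<forall>x\<in>D. ((\<lambda>h. inverse h *\<^sub>R (T h x - x)) \<longlongrightarrow> A x) (at_right 0))"

definition sector :: "real \<Rightarrow> complex set" where
  "sector \<delta> = {z. z \<noteq> 0 \<and> \<bar>Arg z\<bar> < \<delta>}"

definition hol_on :: "('a::real_normed_vector \<Rightarrow> 'a) \<Rightarrow> complex set \<Rightarrow> (complex \<Rightarrow> 'a) \<Rightarrow> bool" where
  "hol_on J U f \<longleftrightarrow> (\<forall>z\<in>U. \<exists>v. (f has_derivative (\<lambda>h. cscale J h v)) (at z))"

text \<open>Bounded analytic semigroup (Engel--Nagel, Def. II.4.5): T extends to a sector of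
  angle \<delta> analytically, with the semigroup law, bounded and strongly continuous at 0
  on every smaller closed subsector.\<close>
definition bounded_analytic_sg :: "('a::real_normed_vector \<Rightarrow> 'a) \<Rightarrow> (real \<Rightarrow> 'a \<Rightarrow> 'a) \<Rightarrow> bool" where
  "bounded_analytic_sg J T0 \<longleftrightarrow> (\<exists>\<delta> T. 0 < \<delta> \<and> \<delta> \<le> pi / 2 \<and>
     (\<forall>t>0. T (complex_of_real t) = T0 t) \<and>
     (\<forall>z\<in>sector \<delta>. bounded_linear (T z)) \<and>
     (\<forall>z1\<in>sector \<delta>. \<forall>z2\<in>sector \<delta>. T (z1 + z2) = T z1 \<circ> T z2) \<and>
     (\<forall>x. hol_on J (sector \<delta>) (\<lambda>z. T z x)) \<and>
     (\<forall>\<delta>'. 0 < \<delta>' \<and> \<delta>' < \<delta> \<longrightarrow>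
        (\<exists>M. \<forall>z\<in>sector \<delta>'. onorm (T z) \<le> M) \<and>
        (\<forall>x. ((\<lambda>z. T z x) \<longlongrightarrow> x) (at 0 within sector \<delta>'))))"

definition bdd_invertible :: "'a set \<Rightarrow> ('a::real_normed_vector \<Rightarrow> 'b::real_normed_vector) \<Rightarrow> bool" where
  "bdd_invertible D A \<longleftrightarrow> bij_betw A D UNIV \<and> bounded_linear (inv_into D A)"

definition resolvent :: "'a set \<Rightarrow> ('a::real_vector \<Rightarrow> 'a) \<Rightarrow> real \<Rightarrow> 'a \<Rightarrow> 'a" where
  "resolvent D A l = inv_into D (\<lambda>v. l *\<^sub>R v - A v)"

text \<open>Negative fractional power (-A)^{-\<alpha>}, 0 < \<alpha> < 1, via Balakrishnan's formula.\<close>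
definition neg_frac_pow :: "'a set \<Rightarrow> ('a::real_normed_vector \<Rightarrow> 'a) \<Rightarrow> real \<Rightarrow> 'a \<Rightarrow> 'a" where
  "neg_frac_pow D A \<alpha> x = (sin (pi * \<alpha>) / pi) *\<^sub>R
     integral {0<..} (\<lambda>l. l powr (- \<alpha>) *\<^sub>R resolvent D A l x)"


text \<open>dom((-A)^\<gamma>) for invertible sectorial -A, 0 \<le> \<gamma> \<le> 1:
  for 0 < \<gamma> < 1 it is the range of (-A)^{-\<gamma>}.\<close>
definition frac_dom :: "'a set \<Rightarrow> ('a::real_normed_vector \<Rightarrow> 'a) \<Rightarrow> real \<Rightarrow> 'a set" where
  "frac_dom D A \<gamma> = (if \<gamma> = 0 then UNIV else if \<gamma> = 1 then D else range (neg_frac_pow D A \<gamma>))"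

definition V_str :: "(real \<Rightarrow> 'e \<Rightarrow> 'e::real_vector) \<Rightarrow> (real \<Rightarrow> 'f \<Rightarrow> 'f) \<Rightarrow> ('f \<Rightarrow> 'e) \<Rightarrow> ('f \<Rightarrow> 'f)
    \<Rightarrow> real \<Rightarrow> 'f \<Rightarrow> 'e" where
  "V_str T0 S D0 B \<tau> y = - (\<tau> *\<^sub>R T0 (\<tau> / 2) (D0 (B (S (\<tau> / 2) y))))"

definition Vn_str :: "(real \<Rightarrow> 'e \<Rightarrow> 'e::real_vector) \<Rightarrow> (real \<Rightarrow> 'f \<Rightarrow> 'f) \<Rightarrow> ('f \<Rightarrow> 'e) \<Rightarrow> ('f \<Rightarrow> 'f)
    \<Rightarrow> nat \<Rightarrow> real \<Rightarrow> 'f \<Rightarrow> 'e" where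
  "Vn_str T0 S D0 B n \<tau> y = (\<Sum>j<n. T0 (real (n - 1 - j) * \<tau>) (V_str T0 S D0 B \<tau> (S (real j * \<tau>) y)))"

end

theory Submission
  imports Defs
begin

text \<open>
  On the \<open>j\<close>-th of the \<open>n\<close> time steps of length \<open>\<tau> = t / n\<close>, the Strang splitting replaces the integral of
  \<open>G s = T\<^sub>0 ((k + 1) \<tau> - s) D\<^sub>0 S s z\<close> over \<open>{0..\<tau>}\<close>, with \<open>k = n - 1 - j\<close> and \<open>z = B S (j \<tau>) y\<close>, by the
  midpoint rule. Analyticity gives \<open>\<parallel>A\<^sub>0 T\<^sub>0 u\<parallel> \<le> C / u\<close>, and the range condition on \<open>D\<^sub>0\<close> improves this to
  \<open>\<parallel>A\<^sub>0 T\<^sub>0 u D\<^sub>0\<parallel> \<le> C u\<^bsup>\<gamma>-1\<^esup>\<close>: pointwise by splitting Balakrishnan's integral at \<open>1 / u\<close>, then uniformly by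
  Banach--Steinhaus. Hence \<open>\<parallel>G''\<parallel> \<le> C (k \<tau>)\<^bsup>\<gamma>-2\<^esup>\<close> and the error of the step is at most
  \<open>C \<tau>\<^bsup>1+\<gamma>\<^esup> k\<^bsup>\<gamma>-2\<^esup>\<close> for \<open>k \<ge> 1\<close>. For \<open>k = 0\<close>, where \<open>G\<close> is only \<open>\<gamma>\<close>-Hoelder at the endpoint, it is at most
  \<open>C \<tau>\<^bsup>1+\<gamma>\<^esup>\<close>. Summing over \<open>k\<close> costs at worst a harmonic sum, i.e. the logarithm.
\<close>

text \<open>The estimates must be extracted from qualitative hypotheses. Analyticity is given as
  complex differentiability on a sector, which does not mention the generator; the bound
  \<open>C / u\<close> comes from a Cauchy estimate on discs whose radius is proportional to their
  centre \<open>u\<close>. Balakrishnan's formula is written with a resolvent defined as an inverse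
  function, so bijectivity of \<open>l - A\<close> has to be derived from the semigroup before the
  integrand can be estimated. Boundedness of \<open>D0\<close> follows from the closedness of the
  map from \<open>x\<close> to \<open>(Am x, L x)\<close>, through the closed graph theorem; that
  theorem and Banach--Steinhaus are both consequences of one lemma of Zabreiko. Orbits of
  \<open>S\<close> are differentiable only for vectors of \<open>domB\<close>, so \<open>G\<close>
  is differentiated by a product rule for strongly continuous families. Its second derivative
  contains \<open>B (B z)\<close>, and \<open>z\<close> already carries one factor \<open>B\<close>:
  this is where three powers of \<open>B\<close> on \<open>y\<close> come from. The less singular
  terms of the second derivative are raised to the common rate at the price of powers of the time
  horizon, so the constant depends on \<open>tmax\<close>.\<close>

section \<open>Baire category and bounded operators\<close>

lemma Baire_closed_cover:
  fixes C :: "nat \<Rightarrow> 'a::banach set"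
  assumes "\<And>n. closed (C n)" and "(\<Union>n. C n) = UNIV"
  shows "\<exists>n x e. 0 < e \<and> ball x e \<subseteq> C n"
proof (rule ccontr)
  assume *: "\<not> ?thesis"
  have "interior (C n) = {}" for n
  proof (rule ccontr)
    assume "interior (C n) \<noteq> {}"
    then obtain x where "x \<in> interior (C n)" by blast
    then show False using * by (auto simp: mem_interior)
  qed
  then have "Met_TC.mtopology interior_of (\<Union>(range C)) = {}"
    using assms(1) complete_UNIV
    by (intro Met_TC.metric_Baire_category_alt) (auto simp: closed_closedin[symmetric])
  then show False using assms(2) by simp
qed

text \<open>Zabreiko's lemma: a countably subadditive seminorm on a Banach space is continuous.
  Baire's theorem makes some sublevel set dense in a ball, so every vector is approximated up to
  half its norm by one on which \<open>p\<close> is controlled; iterating expands the vector into a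
  series to which countable subadditivity applies.\<close>

lemma zabreiko:
  fixes p :: "'a::banach \<Rightarrow> real"
  assumes nonneg: "\<And>x. 0 \<le> p x"
    and scale: "\<And>c x. p (c *\<^sub>R x) = \<bar>c\<bar> * p x"
    and subadd: "\<And>u. summable u \<Longrightarrow> summable (\<lambda>n. p (u n)) \<Longrightarrow> p (suminf u) \<le> (\<Sum>n. p (u n))"
  obtains K where "0 \<le> K" "\<And>x. p x \<le> K * norm x"
proof -
  have p0: "p 0 = 0" using scale[of 0 0] by simp
  have add: "p (x + y) \<le> p x + p y" for x y
  proof -
    define u where "u = (\<lambda>n::nat. if n = 0 then x else if n = 1 then y else 0)"
    have "u sums (\<Sum>n\<in>{0,1}. u n)"
      by (rule sums_finite) (auto simp: u_def)
    moreover have "(\<lambda>n. p (u n)) sums (\<Sum>n\<in>{0,1}. p (u n))"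
      by (rule sums_finite) (auto simp: u_def p0)
    ultimately show ?thesis
      using subadd[of u] by (simp add: sums_iff u_def)
  qed
  have diff: "p (x - y) \<le> p x + p y" for x y
    using add[of x "- y"] scale[of "-1" y] by simp
  \<comment> \<open>Closures are taken because the sublevel sets of \<open>p\<close> are not known
    to be closed; the price is that membership only yields nearby points with small
    \<open>p\<close>.\<close>
  define C where "C = (\<lambda>n::nat. closure {x. p x \<le> real n})"
  have "(\<Union>n. C n) = UNIV"
  proof (safe; simp)
    fix x
    obtain n :: nat where "p x \<le> real n" using real_arch_simple by blast
    then show "\<exists>n. x \<in> C n"
      unfolding C_def by (intro exI[of _ n] subsetD[OF closure_subset]) simp
  qed
  then obtain N x0 e where e: "0 < e" and ball: "ball x0 e \<subseteq> C N"
    using Baire_closed_cover[of C] unfolding C_def by auto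
  \<comment> \<open>Approximating both \<open>x0 + h\<close> and \<open>x0\<close> and subtracting
    moves the ball from \<open>x0\<close> to the origin, which doubles the bound on
    \<open>p\<close>.\<close>
  have small: "\<exists>u. p u \<le> 2 * real N \<and> norm (h - u) < \<eta>" if h: "norm h < e" and \<eta>: "0 < \<eta>" for h \<eta>
  proof -
    have "x0 + h \<in> C N" "x0 \<in> C N"
      using ball h e by (auto simp: subset_iff dist_norm)
    then obtain a b where "p a \<le> real N" "dist a (x0 + h) < \<eta> / 2" "p b \<le> real N" "dist b x0 < \<eta> / 2"
      using \<eta> unfolding C_def closure_approachable by (metis half_gt_zero mem_Collect_eq)
    moreover have "norm (h - (a - b)) \<le> norm (b - x0) + norm (a - (x0 + h))"
      using norm_triangle_ineq4[of "b - x0" "a - (x0 + h)"] by (simp add: algebra_simps)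
    ultimately show ?thesis
      using diff[of a b] by (intro exI[of _ "a - b"]) (simp add: dist_norm)
  qed
  \<comment> \<open>Scaling \<open>x\<close> to norm \<open>e / 2\<close>, approximating there with
    \<open>p\<close> at most \<open>2 * N\<close>, and scaling back gives the factor
    \<open>2 * N / (e / 2)\<close>.\<close>
  define K0 where "K0 = 4 * real N / e"
  have K0: "0 \<le> K0" using e by (simp add: K0_def)
  have "\<exists>u. p u \<le> K0 * norm x \<and> norm (x - u) \<le> norm x / 2" for x
  proof (cases "x = 0")
    case True
    then show ?thesis by (intro exI[of _ 0]) (simp add: p0)
  next
    case False
    define c where "c = e / (2 * norm x)"
    have c: "0 < c" using False e by (simp add: c_def)
    have "norm (c *\<^sub>R x) < e" using False e by (simp add: c_def)
    moreover have "0 < c * norm x / 2" using c False by simp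
    ultimately obtain u where u: "p u \<le> 2 * real N" "norm (c *\<^sub>R x - u) < c * norm x / 2"
      using small by blast
    have "p ((1 / c) *\<^sub>R u) \<le> K0 * norm x"
      unfolding scale using u(1) c False e by (simp add: c_def K0_def field_simps)
    moreover have "norm (x - (1 / c) *\<^sub>R u) \<le> norm x / 2"
    proof -
      have "x - (1 / c) *\<^sub>R u = (1 / c) *\<^sub>R (c *\<^sub>R x - u)"
        using c by (simp add: scaleR_diff_right)
      then have "norm (x - (1 / c) *\<^sub>R u) = (1 / c) * norm (c *\<^sub>R x - u)"
        using c by simp
      also have "\<dots> \<le> (1 / c) * (c * norm x / 2)"
        using u(2) c by (intro mult_left_mono) auto
      finally show ?thesis using c by simp
    qed
    ultimately show ?thesis by blast
  qed
  then obtain f where f: "\<And>x. p (f x) \<le> K0 * norm x" "\<And>x. norm (x - f x) \<le> norm x / 2"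
    by metis
  have "p x \<le> 2 * K0 * norm x" for x
  proof -
    \<comment> \<open>\<open>r n\<close> is the remainder after \<open>n\<close> approximations. Its
      norm halves each time, so the values of \<open>p\<close> on the terms are dominated by a
      geometric series of sum \<open>2 * K0 * norm x\<close>.\<close>
    define r where "r = rec_nat x (\<lambda>_ z. z - f z)"
    have r0: "r 0 = x" and rS: "\<And>n. r (Suc n) = r n - f (r n)" by (simp_all add: r_def)
    have rb: "norm (r n) \<le> norm x * (1 / 2) ^ n" for n
    proof (induction n)
      case (Suc n)
      then show ?case using f(2)[of "r n"] by (simp add: rS)
    qed (simp add: r0)
    have "(\<lambda>n. norm x * (1 / 2) ^ n) \<longlonglongrightarrow> norm x * 0"
      by (intro tendsto_intros LIMSEQ_power_zero) auto
    then have "r \<longlonglongrightarrow> 0"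
      using rb by (intro Lim_null_comparison[where f=r]) (auto intro: always_eventually)
    moreover have sum: "(\<Sum>k<n. f (r k)) = x - r n" for n
      by (induction n) (auto simp: r0 rS)
    ultimately have s: "(\<lambda>n. f (r n)) sums x"
      unfolding sums_def sum using tendsto_diff[OF tendsto_const, of r 0 sequentially x] by simp
    have pb: "p (f (r n)) \<le> K0 * norm x * (1 / 2) ^ n" for n
      using f(1)[of "r n"] mult_left_mono[OF rb[of n] K0] by (simp add: mult.assoc)
    have g: "(\<lambda>n. K0 * norm x * (1 / 2) ^ n) sums (K0 * norm x * 2)"
      using geometric_sums[of "1/2::real"] by (intro sums_mult) simp
    have "summable (\<lambda>n. p (f (r n)))"
      using pb nonneg by (intro summable_comparison_test'[OF sums_summable[OF g], of 0]) auto
    then have "p x \<le> (\<Sum>n. p (f (r n)))" "(\<Sum>n. p (f (r n))) \<le> (\<Sum>n. K0 * norm x * (1 / 2) ^ n)"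
      using subadd[of "\<lambda>n. f (r n)"] s pb sums_summable[OF g] by (auto simp: sums_iff intro!: suminf_le)
    then show ?thesis using g by (simp add: sums_iff)
  qed
  then show ?thesis using K0 by (intro that[of "2 * K0"]) auto
qed

text \<open>Zabreiko's lemma for the seminorm given by the pointwise supremum: continuity of each
  single operator gives countable subadditivity, and this survives the supremum.\<close>

lemma uniform_boundedness:
  fixes T :: "'i \<Rightarrow> 'a::banach \<Rightarrow> 'b::banach"
  assumes bl: "\<And>i. i \<in> I \<Longrightarrow> bounded_linear (T i)"
    and pt: "\<And>x. \<exists>M. \<forall>i\<in>I. norm (T i x) \<le> M"
  obtains K where "0 \<le> K" "\<And>i x. i \<in> I \<Longrightarrow> norm (T i x) \<le> K * norm x"
proof (cases "I = {}")
  case True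
  then show ?thesis using that[of 0] by simp
next
  case False
  define p where "p = (\<lambda>x. SUP i\<in>I. norm (T i x))"
  have bdd: "bdd_above ((\<lambda>i. norm (T i x)) ` I)" for x
    using pt[of x] by (auto simp: bdd_above_def)
  have up: "norm (T i x) \<le> p x" if "i \<in> I" for i x
    unfolding p_def using that bdd by (intro cSUP_upper)
  have least: "p x \<le> M" if "\<And>i. i \<in> I \<Longrightarrow> norm (T i x) \<le> M" for x M
    unfolding p_def using that False by (intro cSUP_least)
  have nn: "0 \<le> p x" for x
    using False up by (metis norm_ge_zero order_trans ex_in_conv)
  have le: "p (c *\<^sub>R x) \<le> \<bar>c\<bar> * p x" for c x
    by (rule least) (simp add: linear_simps[OF bl] up mult_left_mono)
  have "\<bar>c\<bar> * p x \<le> p (c *\<^sub>R x)" for c x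
  proof (cases "c = 0")
    case True
    then show ?thesis using nn by simp
  next
    case False
    then show ?thesis using le[of "inverse c" "c *\<^sub>R x"] by (simp add: field_simps)
  qed
  then have sc: "p (c *\<^sub>R x) = \<bar>c\<bar> * p x" for c x
    using le by (intro antisym)
  have sub: "p (suminf u) \<le> (\<Sum>n. p (u n))" if u: "summable u" "summable (\<lambda>n. p (u n))" for u
  proof (rule least)
    fix i assume i: "i \<in> I"
    have s: "summable (\<lambda>n. norm (T i (u n)))"
      using up[OF i] by (intro summable_comparison_test'[OF u(2), of 0]) auto
    have "norm (T i (suminf u)) = norm (\<Sum>n. T i (u n))"
      using bounded_linear.suminf[OF bl[OF i] u(1)] by simp
    also have "\<dots> \<le> (\<Sum>n. norm (T i (u n)))"
      by (rule summable_norm[OF s])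
    also have "\<dots> \<le> (\<Sum>n. p (u n))"
      using up[OF i] s u(2) by (intro suminf_le) auto
    finally show "norm (T i (suminf u)) \<le> (\<Sum>n. p (u n))" .
  qed
  obtain K where "0 \<le> K" "\<And>x. p x \<le> K * norm x"
    using zabreiko[of p] nn sc sub by blast
  then show ?thesis using that[of K] up by (meson order_trans)
qed

text \<open>Zabreiko's lemma for \<open>norm (f x)\<close>. If the images of the terms are
  absolutely summable, the images of the partial sums converge, and the closed graph identifies
  their limit with the image of the sum.\<close>

lemma closed_graph_bounded_linear:
  fixes f :: "'a::banach \<Rightarrow> 'b::banach"
  assumes "linear f"
    and cl: "\<And>u x y. u \<longlonglongrightarrow> x \<Longrightarrow> (\<lambda>n. f (u n)) \<longlonglongrightarrow> y \<Longrightarrow> f x = y"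
  shows "bounded_linear f"
proof -
  interpret linear f by fact
  obtain K where "\<And>x. norm (f x) \<le> K * norm x"
  proof (rule zabreiko[of "\<lambda>x. norm (f x)"])
    fix u :: "nat \<Rightarrow> 'a" assume u: "summable u" "summable (\<lambda>n. norm (f (u n)))"
    have "(\<lambda>n. f (sum u {..<n})) \<longlonglongrightarrow> (\<Sum>n. f (u n))"
      using summable_LIMSEQ[OF summable_norm_cancel[OF u(2)]] by (simp add: sum)
    then have "f (suminf u) = (\<Sum>n. f (u n))"
      using cl summable_LIMSEQ[OF u(1)] by blast
    then show "norm (f (suminf u)) \<le> (\<Sum>n. norm (f (u n)))"
      using summable_norm[OF u(2)] by simp
  qed (auto simp: scale)
  then show ?thesis
    by unfold_locales (metis mult.commute)
qed

section \<open>Differentiation of strongly continuous operator families\<close>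

text \<open>Brings vector derivatives into the shape of the limit that defines a generator; the
  restriction to \<open>S\<close> covers one-sided derivatives as well.\<close>

lemma has_vector_derivative_quotient:
  fixes f :: "real \<Rightarrow> 'a::real_normed_vector"
  shows "(f has_vector_derivative f') (at s within S) \<longleftrightarrow>
    ((\<lambda>r. inverse (r - s) *\<^sub>R (f r - f s)) \<longlongrightarrow> f') (at s within S)"
proof -
  have eq: "norm (inverse (r - s) *\<^sub>R (f r - f s) - f') = norm (f r - f s - (r - s) *\<^sub>R f') / norm (r - s)"
    if "r \<noteq> s" for r
  proof -
    have "inverse (r - s) *\<^sub>R (f r - f s) - f' = inverse (r - s) *\<^sub>R (f r - f s - (r - s) *\<^sub>R f')"
      using that by (simp add: scaleR_diff_right)
    then show ?thesis by (simp add: divide_inverse mult.commute)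
  qed
  have "((\<lambda>r. inverse (r - s) *\<^sub>R (f r - f s)) \<longlongrightarrow> f') (at s within S) \<longleftrightarrow>
      ((\<lambda>r. norm (inverse (r - s) *\<^sub>R (f r - f s) - f')) \<longlongrightarrow> 0) (at s within S)"
    by (simp only: tendsto_norm_zero_iff LIM_zero_iff)
  also have "\<dots> \<longleftrightarrow> ((\<lambda>r. norm (f r - f s - (r - s) *\<^sub>R f') / norm (r - s)) \<longlongrightarrow> 0) (at s within S)"
    using eq by (intro filterlim_cong refl) (auto simp: eventually_at_filter)
  also have "\<dots> \<longleftrightarrow> (f has_vector_derivative f') (at s within S)"
    by (simp add: has_vector_derivative_def has_derivative_iff_norm bounded_linear_scaleR_left)
  finally show ?thesis by blast
qed

lemma strongly_bounded_tendsto: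
  fixes P :: "real \<Rightarrow> 'a::real_normed_vector \<Rightarrow> 'b::real_normed_vector"
  assumes lin: "\<And>r. r \<in> S \<Longrightarrow> bounded_linear (P r)"
    and bound: "\<And>r x. r \<in> S \<Longrightarrow> norm (P r x) \<le> M * norm x"
    and q: "(q \<longlongrightarrow> x) (at s within S)"
    and cont: "((\<lambda>r. P r x) \<longlongrightarrow> y) (at s within S)"
  shows "((\<lambda>r. P r (q r)) \<longlongrightarrow> y) (at s within S)"
proof -
  have "((\<lambda>r. M * norm (q r - x)) \<longlongrightarrow> M * norm (x - x)) (at s within S)"
    by (intro tendsto_intros q)
  then have "((\<lambda>r. P r (q r - x)) \<longlongrightarrow> 0) (at s within S)"
    using bound by (intro Lim_null_comparison[where f="\<lambda>r. P r (q r - x)"])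
      (auto simp: eventually_at_filter)
  from tendsto_add[OF this cont] have *: "((\<lambda>r. P r (q r - x) + P r x) \<longlongrightarrow> y) (at s within S)"
    by simp
  show ?thesis
    by (rule Lim_transform_eventually[OF *])
      (auto simp: eventually_at_filter linear_simps[OF lin])
qed

text \<open>No operator-norm continuity of \<open>P\<close> is assumed. The quotient is split into
  the increment of \<open>P\<close> at the fixed vector \<open>w s\<close> and \<open>P r\<close>
  applied to the quotient of \<open>w\<close>; the uniform bound controls the latter, where operator
  and argument move together.\<close>

lemma strong_product_rule:
  fixes P :: "real \<Rightarrow> 'a::real_normed_vector \<Rightarrow> 'b::real_normed_vector"
  assumes lin: "\<And>r. r \<in> S \<Longrightarrow> bounded_linear (P r)" and s: "s \<in> S"
    and bound: "\<And>r x. r \<in> S \<Longrightarrow> norm (P r x) \<le> M * norm x"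
    and P': "((\<lambda>r. P r (w s)) has_vector_derivative z) (at s within S)"
    and cont: "((\<lambda>r. P r w') \<longlongrightarrow> P s w') (at s within S)"
    and w: "(w has_vector_derivative w') (at s within S)"
  shows "((\<lambda>r. P r (w r)) has_vector_derivative (z + P s w')) (at s within S)"
proof -
  have "((\<lambda>r. P r (inverse (r - s) *\<^sub>R (w r - w s))) \<longlongrightarrow> P s w') (at s within S)"
    using lin bound w cont unfolding has_vector_derivative_quotient
    by (rule strongly_bounded_tendsto)
  from tendsto_add[OF P'[unfolded has_vector_derivative_quotient] this]
  have *: "((\<lambda>r. inverse (r - s) *\<^sub>R (P r (w s) - P s (w s)) + P r (inverse (r - s) *\<^sub>R (w r - w s)))
      \<longlongrightarrow> z + P s w') (at s within S)" .
  show ?thesis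
    unfolding has_vector_derivative_quotient
    by (rule Lim_transform_eventually[OF *])
      (auto simp: eventually_at_filter linear_simps[OF lin] scaleR_diff_right)
qed

section \<open>Semigroups and their generators\<close>

locale semigroup_generator =
  fixes D :: "'a::banach set" and A :: "'a \<Rightarrow> 'a" and T :: "real \<Rightarrow> 'a \<Rightarrow> 'a"
  assumes gen: "generates D A T"
begin

lemma T_0 [simp]: "T 0 x = x"
  using gen by (simp add: generates_def c0_semigroup_def)

lemma bl: "0 \<le> t \<Longrightarrow> bounded_linear (T t)"
  using gen by (simp add: generates_def c0_semigroup_def)

lemma T_add: "0 \<le> t \<Longrightarrow> 0 \<le> s \<Longrightarrow> T (t + s) x = T t (T s x)"
  using gen by (simp add: generates_def c0_semigroup_def)

lemma T_commute: "0 \<le> t \<Longrightarrow> 0 \<le> s \<Longrightarrow> T t (T s x) = T s (T t x)"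
  by (metis T_add add.commute)

lemma cont: "continuous_on {0..} (\<lambda>t. T t x)"
  using gen by (simp add: generates_def c0_semigroup_def)

text \<open>Domain membership and value become a single limit statement, so that linearity of
  \<open>A\<close> and its commutation with operators follow from limit calculus.\<close>

lemma generator_iff:
  "((\<lambda>h. inverse h *\<^sub>R (T h x - x)) \<longlongrightarrow> y) (at_right 0) \<longleftrightarrow> x \<in> D \<and> A x = y"
proof
  assume L: "((\<lambda>h. inverse h *\<^sub>R (T h x - x)) \<longlongrightarrow> y) (at_right 0)"
  then have "x \<in> D" using gen by (auto simp: generates_def)
  then show "x \<in> D \<and> A x = y"
    using gen tendsto_unique[OF trivial_limit_at_right_real _ L] by (simp add: generates_def)
qed (use gen in \<open>auto simp: generates_def\<close>)

lemma generator_limit: "x \<in> D \<Longrightarrow> ((\<lambda>h. inverse h *\<^sub>R (T h x - x)) \<longlongrightarrow> A x) (at_right 0)"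
  by (simp add: generator_iff)

lemma eventually_at_right_0: "(\<And>h::real. 0 < h \<Longrightarrow> P h) \<Longrightarrow> eventually P (at_right 0)"
  by (auto simp: eventually_at_filter)

lemma generator_add: "x \<in> D \<Longrightarrow> y \<in> D \<Longrightarrow> x + y \<in> D \<and> A (x + y) = A x + A y"
  unfolding generator_iff[symmetric]
  using tendsto_add[OF generator_limit generator_limit]
  by (rule Lim_transform_eventually)
    (auto intro!: eventually_at_right_0 simp: linear_simps[OF bl] algebra_simps)

text \<open>A bounded operator commuting with the semigroup passes through the difference quotient.
  It is applied to scalar multiplication and to the semigroup itself.\<close>

lemma generator_commute:
  assumes P: "bounded_linear P" and comm: "\<And>h x. 0 \<le> h \<Longrightarrow> P (T h x) = T h (P x)" and x: "x \<in> D"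
  shows "P x \<in> D \<and> A (P x) = P (A x)"
  unfolding generator_iff[symmetric]
  using bounded_linear.tendsto[OF P generator_limit[OF x]]
  by (rule Lim_transform_eventually)
    (auto intro!: eventually_at_right_0 simp: linear_simps[OF P] comm)

lemma generator_scale: "x \<in> D \<Longrightarrow> c *\<^sub>R x \<in> D \<and> A (c *\<^sub>R x) = c *\<^sub>R A x"
  by (rule generator_commute) (auto simp: linear_simps[OF bl] bounded_linear_scaleR_right)

lemma generator_diff: "x \<in> D \<Longrightarrow> y \<in> D \<Longrightarrow> x - y \<in> D \<and> A (x - y) = A x - A y"
  using generator_add[of x "- 1 *\<^sub>R y"] generator_scale[of y "-1"] by simp

lemma generator_semigroup: "x \<in> D \<Longrightarrow> 0 \<le> t \<Longrightarrow> T t x \<in> D \<and> A (T t x) = T t (A x)"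
  by (rule generator_commute) (auto simp: bl T_commute)

lemma locally_bounded:
  obtains N where "0 \<le> N" "\<And>s x. 0 \<le> s \<Longrightarrow> s \<le> t \<Longrightarrow> norm (T s x) \<le> N * norm x"
proof (rule uniform_boundedness[of "{0..t}" T])
  fix x
  have "compact ((\<lambda>s. T s x) ` {0..t})"
    by (intro compact_continuous_image continuous_on_subset[OF cont]) auto
  from compact_imp_bounded[OF this] show "\<exists>M. \<forall>s\<in>{0..t}. norm (T s x) \<le> M"
    by (auto simp: bounded_iff)
qed (auto simp: bl intro: that)

text \<open>The generator is only a right derivative at time 0. To the right of \<open>s\<close> one
  factors out \<open>T s\<close>; to the left one factors out \<open>T r\<close> with moving
  \<open>r\<close>, which requires the local bound from Banach--Steinhaus.\<close>

lemma orbit_derivative: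
  assumes x: "x \<in> D" and s: "0 \<le> s"
  shows "((\<lambda>s. T s x) has_vector_derivative T s (A x)) (at s within {0..})"
  unfolding has_vector_derivative_def has_derivative_within_alt2
proof (intro conjI allI impI)
  show "bounded_linear (\<lambda>r. r *\<^sub>R T s (A x))" by (rule bounded_linear_scaleR_left)
  fix e :: real assume e: "0 < e"
  obtain N where N: "0 \<le> N" "\<And>r x. 0 \<le> r \<Longrightarrow> r \<le> s \<Longrightarrow> norm (T r x) \<le> N * norm x"
    using locally_bounded[of s] by metis
  \<comment> \<open>The left-hand case produces two errors of size \<open>\<epsilon> * h\<close>
    under an operator bounded by \<open>N\<close>; the summand 1 covers
    \<open>N = 0\<close>.\<close>
  define \<epsilon> where "\<epsilon> = e / (2 * N + 1)"
  have "0 < \<epsilon>" "2 * N * \<epsilon> \<le> e"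
    using e N(1) by (simp_all add: \<epsilon>_def divide_simps)
  then have \<epsilon>: "0 < \<epsilon>" "2 * N * \<epsilon> \<le> e" "N * \<epsilon> \<le> e"
    using mult_nonneg_nonneg[OF N(1), of \<epsilon>] by linarith+
  have "eventually (\<lambda>h. dist (inverse h *\<^sub>R (T h x - x)) (A x) < \<epsilon>) (at_right 0)"
    by (rule tendstoD[OF generator_limit[OF x] \<epsilon>(1)])
  moreover have "((\<lambda>h. T h (A x)) \<longlongrightarrow> T 0 (A x)) (at 0 within {0..})"
    using cont[of "A x"] unfolding continuous_on_def by (rule bspec) simp
  then have "((\<lambda>h. T h (A x)) \<longlongrightarrow> T 0 (A x)) (at_right 0)"
    by (rule tendsto_within_subset) auto
  from tendstoD[OF this \<epsilon>(1)] have "eventually (\<lambda>h. dist (T h (A x)) (A x) < \<epsilon>) (at_right 0)"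
    by simp
  ultimately have "eventually (\<lambda>h. dist (inverse h *\<^sub>R (T h x - x)) (A x) < \<epsilon> \<and> dist (T h (A x)) (A x) < \<epsilon>) (at_right 0)"
    by eventually_elim simp
  then obtain d where d: "0 < d" and
    lim: "\<And>h. 0 < h \<Longrightarrow> h < d \<Longrightarrow> dist (inverse h *\<^sub>R (T h x - x)) (A x) < \<epsilon> \<and> dist (T h (A x)) (A x) < \<epsilon>"
    unfolding eventually_at_right_field by blast
  have q: "norm (T h x - x - h *\<^sub>R A x) \<le> \<epsilon> * h" if "0 < h" "h < d" for h
  proof -
    have "T h x - x - h *\<^sub>R A x = h *\<^sub>R (inverse h *\<^sub>R (T h x - x) - A x)"
      using that by (simp add: scaleR_diff_right)
    then have "norm (T h x - x - h *\<^sub>R A x) = h * dist (inverse h *\<^sub>R (T h x - x)) (A x)"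
      using that by (simp add: dist_norm)
    also have "\<dots> \<le> h * \<epsilon>"
      using lim[OF that] that by (intro mult_left_mono) auto
    finally show ?thesis by (simp add: mult.commute)
  qed
  show "eventually (\<lambda>r. norm (T r x - T s x - (r - s) *\<^sub>R T s (A x)) \<le> e * norm (r - s)) (at s within {0..})"
    unfolding eventually_at
  proof (intro exI conjI ballI impI)
    show "0 < d" by fact
    fix r assume r: "r \<in> {0..}" and rs: "r \<noteq> s \<and> dist r s < d"
    consider "s < r" | "r < s" using rs by linarith
    then show "norm (T r x - T s x - (r - s) *\<^sub>R T s (A x)) \<le> e * norm (r - s)"
    proof cases
      case 1
      define h where "h = r - s"
      have h: "0 < h" "h < d" using 1 rs by (auto simp: h_def dist_norm)
      have "T r x = T s (T h x)" using T_add[of s h] s h by (simp add: h_def)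
      then have "T r x - T s x - (r - s) *\<^sub>R T s (A x) = T s (T h x - x - h *\<^sub>R A x)"
        by (simp add: linear_simps[OF bl[OF s]] h_def)
      also have "norm \<dots> \<le> N * (\<epsilon> * h)"
        using N(2)[OF s order_refl] mult_left_mono[OF q[OF h] N(1)] by (rule order_trans)
      also have "\<dots> \<le> e * h"
        using mult_right_mono[OF \<epsilon>(3), of h] h by (simp add: mult.assoc)
      finally show ?thesis using h by (simp add: h_def)
    next
      case 2
      define h where "h = s - r"
      have h: "0 < h" "h < d" using 2 rs by (auto simp: h_def dist_norm)
      have r0: "0 \<le> r" using r by simp
      have "T s y = T r (T h y)" for y using T_add[of r h] r0 h by (simp add: h_def)
      \<comment> \<open>The term \<open>T h (A x) - A x\<close> pays for evaluating the derivative
        at \<open>s\<close> although \<open>T r\<close> is factored out.\<close>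
      then have "T r x - T s x - (r - s) *\<^sub>R T s (A x)
          = T r (h *\<^sub>R (T h (A x) - A x) - (T h x - x - h *\<^sub>R A x))"
        by (simp add: linear_simps[OF bl[OF r0]] h_def algebra_simps)
      also have "norm \<dots> \<le> N * norm (h *\<^sub>R (T h (A x) - A x) - (T h x - x - h *\<^sub>R A x))"
        using N(2) r0 2 by simp
      also have "\<dots> \<le> N * (h * \<epsilon> + \<epsilon> * h)"
      proof (rule mult_left_mono[OF order_trans[OF norm_triangle_ineq4 add_mono] N(1)])
        show "norm (h *\<^sub>R (T h (A x) - A x)) \<le> h * \<epsilon>"
          using lim[OF h] h by (simp add: dist_norm)
      qed (rule q[OF h])
      also have "\<dots> \<le> e * h" using mult_right_mono[OF \<epsilon>(2), of h] h by (simp add: algebra_simps)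
      finally show ?thesis using h by (simp add: h_def)
    qed
  qed
qed

lemma orbit_derivative_at:
  assumes "x \<in> D" and "0 < s"
  shows "((\<lambda>s. T s x) has_vector_derivative T s (A x)) (at s)"
proof -
  have "at s within {0..} = at s"
    using assms(2) by (intro at_within_open_subset[of s "{0<..}"]) auto
  then show ?thesis using orbit_derivative[OF assms(1), of s] assms(2) by simp
qed

text \<open>The truncated Laplace transform nearly inverts \<open>l - A\<close>: the defect is
  \<open>exp (- l * t) *\<^sub>R T t x\<close>. Applying \<open>T h\<close> shifts the integration
  window, so the difference quotient at the generator reduces to the fundamental theorem at both
  ends of the window.\<close>

lemma truncated_Laplace:
  fixes l :: real
  defines "W \<equiv> \<lambda>t x. integral {0..t} (\<lambda>s. exp (- l * s) *\<^sub>R T s x)"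
  assumes t: "0 \<le> t"
  shows "W t x \<in> D \<and> A (W t x) = exp (- l * t) *\<^sub>R T t x - x + l *\<^sub>R W t x"
proof -
  define g where "g = (\<lambda>s. exp (- l * s) *\<^sub>R T s x)"
  have W: "W t x = integral {0..t} g" for t by (simp add: W_def g_def)
  have W0: "W 0 x = 0" by (simp add: W)
  have cg: "continuous_on {a..b} g" if "0 \<le> a" for a b
    unfolding g_def using that by (intro continuous_intros continuous_on_subset[OF cont]) auto
  have ig: "g integrable_on {a..b}" if "0 \<le> a" for a b
    using cg[OF that] by (rule integrable_continuous_real)
  have dW: "((\<lambda>h. inverse h *\<^sub>R (W (t + h) x - W t x)) \<longlongrightarrow> g t) (at_right 0)" if t: "0 \<le> t" for t
  proof -
    have "((\<lambda>u. W u x) has_vector_derivative g t) (at t within {0..t + 1})"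
      unfolding W using t by (intro integral_has_vector_derivative cg) auto
    then have "((\<lambda>u. W u x) has_vector_derivative g t) (at t within {t..t + 1})"
      by (rule has_vector_derivative_within_subset) (use t in auto)
    then show ?thesis
      unfolding has_vector_derivative_quotient
      by (simp add: at_within_Icc_at_right filterlim_at_right_to_0[of _ _ t] add.commute)
  qed
  have TW: "T h (W t x) = exp (l * h) *\<^sub>R (W (t + h) x - W h x)" if h: "0 < h" for h
  proof -
    have "(T h \<circ> g) s = exp (l * h) *\<^sub>R (g \<circ> (+) h) s" if "s \<in> {0..t}" for s
      using that h by (simp add: g_def linear_simps[OF bl] T_add flip: exp_add) (simp add: algebra_simps)
    then have "integral {0..t} (T h \<circ> g) = integral {0..t} (\<lambda>s. exp (l * h) *\<^sub>R (g \<circ> (+) h) s)"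
      by (rule integral_cong)
    also have "\<dots> = exp (l * h) *\<^sub>R integral {0 + h..t + h} g"
      by (simp only: integral_cmul integral_shift_Icc_real)
    also have "integral {0 + h..t + h} g = W (t + h) x - W h x"
      using Henstock_Kurzweil_Integration.integral_combine[of 0 h "t + h" g] ig[of 0 "t + h"] h t by (simp add: W algebra_simps)
    finally show ?thesis
      using integral_linear[OF ig bl, of 0 h t] h by (simp add: W o_def)
  qed
  have e: "((\<lambda>h. inverse h * (exp (l * h) - 1)) \<longlongrightarrow> l) (at_right 0)"
  proof -
    have "((\<lambda>h. exp (l * h)) has_vector_derivative l) (at 0 within {0<..})"
      by (auto intro!: derivative_eq_intros simp flip: has_real_derivative_iff_has_vector_derivative)
    then show ?thesis by (simp add: has_vector_derivative_quotient)
  qed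
  \<comment> \<open>By \<open>TW\<close> the quotient splits into difference quotients of
    \<open>W\<close> at \<open>t\<close> and at 0, times \<open>exp (l * h)\<close>, plus the
    quotient of the exponential times \<open>W t x\<close>.\<close>
  have "((\<lambda>h. exp (l * h) *\<^sub>R (inverse h *\<^sub>R (W (t + h) x - W t x) - inverse h *\<^sub>R (W (0 + h) x - W 0 x))
      + (inverse h * (exp (l * h) - 1)) *\<^sub>R W t x) \<longlongrightarrow> exp (l * 0) *\<^sub>R (g t - g 0) + l *\<^sub>R W t x) (at_right 0)"
    by (intro tendsto_intros dW e t order_refl)
  then have "((\<lambda>h. inverse h *\<^sub>R (T h (W t x) - W t x)) \<longlongrightarrow> exp (l * 0) *\<^sub>R (g t - g 0) + l *\<^sub>R W t x) (at_right 0)"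
    by (rule Lim_transform_eventually) (auto intro!: eventually_at_right_0 simp: TW W0 algebra_simps)
  then show ?thesis
    unfolding generator_iff by (simp add: g_def)
qed

end

section \<open>Resolvents of bounded semigroups\<close>

locale bounded_semigroup_generator = semigroup_generator +
  fixes M :: real
  assumes M_nonneg: "0 \<le> M"
    and bound: "0 \<le> t \<Longrightarrow> norm (T t x) \<le> M * norm x"
begin

text \<open>With \<open>w = l *\<^sub>R x - A x\<close>, the derivative of
  \<open>exp (- l * s) *\<^sub>R T s x\<close> is \<open>- exp (- l * s) *\<^sub>R T s w\<close>,
  whose norm is dominated by an explicit exponential. Comparing increments over
  \<open>{0..t}\<close> and letting \<open>t\<close> grow gives the bound without presupposing that
  a resolvent exists.\<close>

lemma resolvent_estimate:
  assumes x: "x \<in> D" and l: "0 < l"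
  shows "l * norm x \<le> M * norm (l *\<^sub>R x - A x)"
proof -
  define w where "w = l *\<^sub>R x - A x"
  have M: "0 \<le> M * norm w" by (simp add: M_nonneg)
  have est: "norm x \<le> M * norm w / l + exp (- l * t) * (M * norm x)" if t: "0 < t" for t
  proof -
    have "norm (exp (- l * t) *\<^sub>R T t x - exp (- l * 0) *\<^sub>R T 0 x)
        \<le> - exp (- l * t) * (M * norm w / l) - (- exp (- l * 0) * (M * norm w / l))"
    proof (rule differentiable_bound_general[OF t])
      show "continuous_on {0..t} (\<lambda>s. exp (- l * s) *\<^sub>R T s x)"
        by (intro continuous_intros continuous_on_subset[OF cont]) auto
      show "continuous_on {0..t} (\<lambda>s. - exp (- l * s) * (M * norm w / l))"
        by (intro continuous_intros)
      fix s assume s: "0 < s" "s < t"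
      show "((\<lambda>s. exp (- l * s) *\<^sub>R T s x) has_vector_derivative - (exp (- l * s) *\<^sub>R T s w)) (at s)"
        using s by (auto intro!: derivative_eq_intros orbit_derivative_at[OF x]
            simp: w_def linear_simps[OF bl] algebra_simps)
      show "((\<lambda>s. - exp (- l * s) * (M * norm w / l)) has_vector_derivative exp (- l * s) * (M * norm w)) (at s)"
        using l by (auto intro!: derivative_eq_intros simp flip: has_real_derivative_iff_has_vector_derivative)
      show "norm (- (exp (- l * s) *\<^sub>R T s w)) \<le> exp (- l * s) * (M * norm w)"
        using bound[of s w] s by simp
    qed
    then have "norm (x - exp (- l * t) *\<^sub>R T t x) \<le> M * norm w / l - exp (- l * t) * (M * norm w / l)"
      by (simp add: norm_minus_commute)
    also have "\<dots> \<le> M * norm w / l" using M l by simp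
    finally have "norm x \<le> M * norm w / l + norm (exp (- l * t) *\<^sub>R T t x)"
      using norm_triangle_sub[of x "exp (- l * t) *\<^sub>R T t x"] by linarith
    also have "norm (exp (- l * t) *\<^sub>R T t x) \<le> exp (- l * t) * (M * norm x)"
      using bound[of t x] t by simp
    finally show ?thesis by simp
  qed
  have "((\<lambda>t. M * norm w / l + exp (- l * t) * (M * norm x)) \<longlongrightarrow> M * norm w / l + 0 * (M * norm x)) at_top"
    using l by (intro tendsto_intros) real_asymp
  then have "norm x \<le> M * norm w / l + 0 * (M * norm x)"
    using eventually_mono[OF eventually_gt_at_top[of "0::real"] est]
    by (rule tendsto_lowerbound[OF _ _ trivial_limit_at_top_linorder])
  then show ?thesis using l by (simp add: w_def field_simps)
qed

text \<open>Injectivity is the a priori estimate. For surjectivity, the truncated Laplace transforms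
  at integer times are approximate preimages whose defects \<open>g n\<close> tend to 0, and
  closedness of \<open>A\<close> passes to the limit.\<close>

lemma resolvent_bij:
  assumes closed: "\<And>u x y. (\<And>n. u n \<in> D) \<Longrightarrow> u \<longlonglongrightarrow> x \<Longrightarrow> (\<lambda>n::nat. A (u n)) \<longlonglongrightarrow> y \<Longrightarrow> x \<in> D \<and> A x = y"
    and l: "0 < l"
  shows "bij_betw (\<lambda>v. l *\<^sub>R v - A v) D UNIV"
  unfolding bij_betw_def
proof (intro conjI inj_onI set_eqI iffI UNIV_I)
  fix x y assume "x \<in> D" "y \<in> D" "l *\<^sub>R x - A x = l *\<^sub>R y - A y"
  then have "l * norm (x - y) \<le> M * norm (0 :: 'a)"
    using resolvent_estimate[of "x - y" l] l generator_diff[of x y] by (simp add: algebra_simps)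
  then show "x = y" using l by (simp add: mult_le_0_iff)
next
  fix x
  define W where "W = (\<lambda>n::nat. integral {0..real n} (\<lambda>s. exp (- l * s) *\<^sub>R T s x))"
  define g where "g = (\<lambda>n::nat. exp (- l * real n) *\<^sub>R T (real n) x)"
  have W: "W n \<in> D" "A (W n) = g n - x + l *\<^sub>R W n" for n
    using truncated_Laplace[of "real n" l x] by (auto simp: W_def g_def)
  have "(\<lambda>n. exp (- l * real n) * (M * norm x)) \<longlonglongrightarrow> 0 * (M * norm x)"
    using l by (intro tendsto_intros) real_asymp
  then have g: "g \<longlonglongrightarrow> 0"
    by (intro Lim_null_comparison[where f=g]) (auto simp: g_def bound)
  \<comment> \<open>Applying \<open>l - A\<close> to \<open>W m - W n\<close> gives the difference
    of the defects up to sign, so the a priori estimate transfers the Cauchy property from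
    \<open>g\<close> to \<open>W\<close>.\<close>
  have "Cauchy W"
  proof (rule CauchyI)
    fix e :: real assume e: "0 < e"
    have "Cauchy (\<lambda>n. (M / l) *\<^sub>R g n)"
      by (rule LIMSEQ_imp_Cauchy[OF tendsto_scaleR[OF tendsto_const g]])
    then obtain N where N: "\<And>m n. m \<ge> N \<Longrightarrow> n \<ge> N \<Longrightarrow> norm ((M / l) *\<^sub>R g m - (M / l) *\<^sub>R g n) < e"
      using CauchyD e by blast
    show "\<exists>N. \<forall>m\<ge>N. \<forall>n\<ge>N. norm (W m - W n) < e"
    proof (intro exI[of _ N] allI impI)
      fix m n assume mn: "N \<le> m" "N \<le> n"
      have "l *\<^sub>R (W m - W n) - A (W m - W n) = - (g m - g n)"
        using generator_diff[OF W(1) W(1)] by (simp add: W(2) algebra_simps)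
      then have "l * norm (W m - W n) \<le> M * norm (g m - g n)"
        using resolvent_estimate[of "W m - W n" l] generator_diff[OF W(1) W(1)] l by (simp add: norm_minus_commute)
      then have "norm (W m - W n) \<le> (M / l) * norm (g m - g n)"
        using l by (simp add: field_simps)
      also have "\<dots> \<le> norm ((M / l) *\<^sub>R g m - (M / l) *\<^sub>R g n)"
        using l by (simp add: divide_right_mono mult_right_mono flip: scaleR_diff_right)
      finally show "norm (W m - W n) < e" using N[OF mn] by linarith
    qed
  qed
  then obtain u where u: "W \<longlonglongrightarrow> u"
    using Cauchy_convergent convergent_def by blast
  have "(\<lambda>n. A (W n)) \<longlonglongrightarrow> 0 - x + l *\<^sub>R u"
    unfolding W(2) by (intro tendsto_intros g u)
  then have "u \<in> D \<and> A u = 0 - x + l *\<^sub>R u"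
    using closed W(1) u by blast
  then show "x \<in> (\<lambda>v. l *\<^sub>R v - A v) ` D"
    by (intro image_eqI[of _ _ u]) auto
qed

end

section \<open>Complex scalars and a vector-valued Cauchy estimate\<close>

lemma bounded_bilinear_cscale:
  assumes "cstruct J"
  shows "bounded_bilinear (cscale J)"
proof -
  have J: "bounded_linear J" using assms by (simp add: cstruct_def)
  obtain K where K: "\<And>x. norm (J x) \<le> norm x * K" "0 \<le> K"
    using bounded_linear.nonneg_bounded[OF J] by blast
  show ?thesis
  proof
    have "norm (cscale J c x) \<le> norm c * norm x * (1 + K)" for c x
    proof -
      have "norm (cscale J c x) \<le> \<bar>Re c\<bar> * norm x + \<bar>Im c\<bar> * norm (J x)"
        unfolding cscale_def by (rule order_trans[OF norm_triangle_ineq]) simp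
      also have "\<dots> \<le> norm c * norm x + norm c * (norm x * K)"
        by (intro add_mono mult_mono abs_Re_le_cmod abs_Im_le_cmod K(1)) auto
      finally show ?thesis by (simp add: algebra_simps)
    qed
    then show "\<exists>K. \<forall>a b. norm (cscale J a b) \<le> norm a * norm b * K" by blast
  qed (auto simp: cscale_def linear_simps[OF J] algebra_simps)
qed

lemma cscale_mult: "cstruct J \<Longrightarrow> cscale J a (cscale J b x) = cscale J (a * b) x"
  by (simp add: cstruct_def cscale_def linear_simps[of J] algebra_simps)

lemma cscale_of_real [simp]: "cscale J (of_real r) x = r *\<^sub>R x"
  by (simp add: cscale_def)

lemma cscale_1 [simp]: "cscale J 1 x = x"
  by (simp add: cscale_def)

lemma norm_cscale_cis: "cstruct J \<Longrightarrow> norm (cscale J (cis \<theta>) x) = norm x"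
  by (simp add: cstruct_def cscale_def)

text \<open>With \<open>K \<rho>\<close> the integral of \<open>exp (- i \<theta>) f (z\<^sub>0 + \<rho> exp (i \<theta>))\<close> over a period and \<open>P \<rho>\<close> that of
  \<open>f' (z\<^sub>0 + \<rho> exp (i \<theta>))\<close>, one has \<open>K' = P\<close>, and integration by parts gives \<open>K \<rho> = \<rho> P \<rho>\<close>; hence \<open>P\<close> is
  constant, equal to \<open>P 0 = 2 \<pi> f' z\<^sub>0\<close>.\<close>

lemma Cauchy_estimate:
  fixes f :: "complex \<Rightarrow> 'a::banach"
  assumes J: "cstruct J" and r: "0 < r"
    and f: "\<And>z. z \<in> cball z0 r \<Longrightarrow> (f has_derivative (\<lambda>h. cscale J h (f' z))) (at z)"
    and f': "continuous_on (cball z0 r) f'"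
    and M: "\<And>z. z \<in> cball z0 r \<Longrightarrow> norm (f z) \<le> M"
  shows "r * norm (f' z0) \<le> M"
proof -
  interpret cs: bounded_bilinear "cscale J" by (rule bounded_bilinear_cscale[OF J])
  define p where "p = (\<lambda>\<rho> \<theta>. z0 + of_real \<rho> * cis \<theta>)"
  have p: "p \<rho> \<theta> \<in> cball z0 r" if "\<rho> \<in> {0..r}" for \<rho> \<theta>
    using that by (auto simp: p_def dist_norm norm_mult)
  define k where "k = (\<lambda>\<rho> \<theta>. cscale J (cis (- \<theta>)) (f (p \<rho> \<theta>)))"
  define K where "K = (\<lambda>\<rho>. integral {0..2*pi} (k \<rho>))"
  define P where "P = (\<lambda>\<rho>. integral {0..2*pi} (\<lambda>\<theta>. f' (p \<rho> \<theta>)))"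
  have fv: "((\<lambda>s. f (q s)) has_vector_derivative cscale J q' (f' (q s))) (at s within S)"
    if "(q has_vector_derivative q') (at s within S)" "q s \<in> cball z0 r" for q q' s S
  proof -
    have "((\<lambda>s. f (q s)) has_derivative (\<lambda>h. cscale J (h *\<^sub>R q') (f' (q s)))) (at s within S)"
      using has_derivative_compose[OF that(1)[unfolded has_vector_derivative_def] f[OF that(2)]] .
    then show ?thesis by (simp add: has_vector_derivative_def cs.scaleR_left)
  qed
  have contf: "continuous_on (cball z0 r) f"
    using f by (intro continuous_at_imp_continuous_on ballI has_derivative_continuous) blast
  have contp: "continuous_on X (\<lambda>x. p (g x) (h x))" if "continuous_on X g" "continuous_on X h" for X g h
    unfolding p_def using that by (intro continuous_intros)
  have contf'p: "continuous_on ({0..r} \<times> {0..2*pi}) (\<lambda>(\<rho>, \<theta>). f' (p \<rho> \<theta>))"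
    unfolding case_prod_beta
    by (rule continuous_on_compose2[OF f']) (auto intro!: contp continuous_intros p)
  have contf'p1: "continuous_on {0..2*pi} (\<lambda>\<theta>. f' (p \<rho> \<theta>))" if "\<rho> \<in> {0..r}" for \<rho>
    by (rule continuous_on_compose2[OF f']) (use that in \<open>auto intro!: contp continuous_intros p\<close>)
  have contk: "continuous_on {0..2*pi} (k \<rho>)" if "\<rho> \<in> {0..r}" for \<rho>
    unfolding k_def
    by (intro cs.continuous_on continuous_on_compose2[OF contf] contp continuous_intros)
      (use that p in auto)
  have cis': "(cis has_vector_derivative \<i> * cis s) (at s within S)" for s S
  proof -
    have "((\<lambda>s. exp (\<i> * of_real s)) has_vector_derivative exp (\<i> * of_real s) * (\<i> * 1)) (at s within S)"
      by (rule has_vector_derivative_real_field) (auto intro!: derivative_eq_intros)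
    then show ?thesis by (simp add: cis_conv_exp[abs_def] mult.commute)
  qed
  have K': "(K has_vector_derivative P \<rho>) (at \<rho> within {0..r})" if \<rho>: "\<rho> \<in> {0..r}" for \<rho>
    unfolding K_def P_def cbox_interval[symmetric, of 0 "2*pi"]
  proof (rule leibniz_rule_vector_derivative)
    fix x t assume x: "x \<in> {0..r}"
    have "((\<lambda>x. p x t) has_vector_derivative cis t) (at x within {0..r})"
      unfolding p_def by (auto intro!: derivative_eq_intros)
    from cs.has_vector_derivative[OF has_vector_derivative_const[of "cis (- t)"] fv[OF this p[OF x]]]
    show "((\<lambda>x. k x t) has_vector_derivative f' (p x t)) (at x within {0..r})"
      by (simp add: k_def cscale_mult[OF J] cis_mult cs.zero_left)
  qed (use \<rho> contk contf'p in \<open>auto intro!: integrable_continuous_real\<close>)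
  have KP: "K \<rho> = \<rho> *\<^sub>R P \<rho>" if \<rho>: "\<rho> \<in> {0..r}" for \<rho>
  proof -
    have "((\<lambda>\<theta>. cscale J (- \<i>) (k \<rho> \<theta> - \<rho> *\<^sub>R f' (p \<rho> \<theta>))) has_integral k \<rho> (2*pi) - k \<rho> 0) {0..2*pi}"
    proof (rule fundamental_theorem_of_calculus)
      fix \<theta>
      have 1: "(p \<rho> has_vector_derivative \<rho> *\<^sub>R (\<i> * cis \<theta>)) (at \<theta> within {0..2*pi})"
        unfolding p_def by (auto intro!: derivative_eq_intros cis' simp: scaleR_conv_of_real)
      have 2: "((\<lambda>\<theta>. cis (- \<theta>)) has_vector_derivative - \<i> * cis (- \<theta>)) (at \<theta> within {0..2*pi})"
        unfolding cis_cnj[symmetric]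
        using bounded_linear.has_vector_derivative[OF bounded_linear_cnj cis'] by simp
      from cs.has_vector_derivative[OF 2 fv[OF 1 p[OF \<rho>]]]
      show "(k \<rho> has_vector_derivative cscale J (- \<i>) (k \<rho> \<theta> - \<rho> *\<^sub>R f' (p \<rho> \<theta>))) (at \<theta> within {0..2*pi})"
        by (simp add: k_def cscale_mult[OF J] cs.diff_right cs.scaleR_right cs.scaleR_left cs.minus_left
            cis_mult mult.left_commute[of "cis (- \<theta>)" \<i>])
    qed simp
    moreover have "cis (- (2 * pi)) = 1" by (simp add: complex_eq_iff)
    then have "k \<rho> (2*pi) = k \<rho> 0" by (simp add: k_def p_def)
    ultimately have 3: "((\<lambda>\<theta>. cscale J (- \<i>) (k \<rho> \<theta> - \<rho> *\<^sub>R f' (p \<rho> \<theta>))) has_integral 0) {0..2*pi}"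
      by simp
    have "((\<lambda>\<theta>. k \<rho> \<theta> - \<rho> *\<^sub>R f' (p \<rho> \<theta>)) has_integral K \<rho> - \<rho> *\<^sub>R P \<rho>) {0..2*pi}"
      unfolding K_def P_def using contk[OF \<rho>] contf'p1[OF \<rho>]
      by (intro has_integral_diff has_integral_cmul integrable_integral integrable_continuous_real)
    from has_integral_linear[OF this cs.bounded_linear_right, of "- \<i>"]
    have "((\<lambda>\<theta>. cscale J (- \<i>) (k \<rho> \<theta> - \<rho> *\<^sub>R f' (p \<rho> \<theta>))) has_integral cscale J (- \<i>) (K \<rho> - \<rho> *\<^sub>R P \<rho>)) {0..2*pi}"
      by (simp add: o_def)
    from has_integral_unique[OF this 3] have "cscale J (- \<i>) (K \<rho> - \<rho> *\<^sub>R P \<rho>) = 0" .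
    then have "cscale J \<i> (cscale J (- \<i>) (K \<rho> - \<rho> *\<^sub>R P \<rho>)) = 0"
      by (simp add: cs.zero_right)
    then show ?thesis by (simp add: cscale_mult[OF J])
  qed
  \<comment> \<open>The quotient of \<open>K\<close> by the radius has derivative zero because
    \<open>KP\<close> cancels the two terms of the product rule. Radius 0 is excluded by the
    division and recovered from continuity of \<open>P\<close>.\<close>
  have const: "P \<rho> = P r" if \<rho>: "\<rho> \<in> {0<..r}" for \<rho>
  proof -
    have "inverse \<rho> *\<^sub>R K \<rho> = inverse r *\<^sub>R K r"
    proof (rule has_derivative_zero_unique[of "{0<..r}"])
      fix x assume x: "x \<in> {0<..r}"
      have Kx: "(K has_vector_derivative P x) (at x within {0<..r})"
        by (rule has_vector_derivative_within_subset[OF K']) (use x in auto)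
      have ix: "(inverse has_real_derivative - (inverse x)\<^sup>2) (at x within {0<..r})"
        using x by (auto intro!: derivative_eq_intros simp: power2_eq_square)
      have "((\<lambda>x. inverse x *\<^sub>R K x) has_vector_derivative inverse x *\<^sub>R P x + (- (inverse x)\<^sup>2) *\<^sub>R K x)
          (at x within {0<..r})"
        by (rule has_vector_derivative_scaleR[OF ix Kx])
      then show "((\<lambda>x. inverse x *\<^sub>R K x) has_derivative (\<lambda>h. 0)) (at x within {0<..r})"
        using x by (simp add: KP has_vector_derivative_def power2_eq_square mult.assoc)
    qed (use \<rho> r in auto)
    then show ?thesis using \<rho> r by (simp add: KP)
  qed
  have "continuous_on {0..r} P"
    unfolding P_def cbox_interval[symmetric, of 0 "2*pi"] using contf'p by (intro integral_continuous_on_param) simp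
  then have "(P \<longlongrightarrow> P 0) (at_right 0)"
    using r by (simp add: continuous_on_Icc_at_rightD)
  moreover have "(P \<longlongrightarrow> P r) (at_right 0)"
    using r
    by (intro tendsto_eventually, unfold eventually_at_right_field) (intro exI[of _ r] conjI allI impI const, auto)
  ultimately have "P 0 = P r"
    using tendsto_unique[OF trivial_limit_at_right_real] by blast
  moreover have "P 0 = (2 * pi) *\<^sub>R f' z0"
    by (simp add: P_def p_def)
  ultimately have "K r = r *\<^sub>R (2 * pi) *\<^sub>R f' z0"
    using KP[of r] r by simp
  moreover have "norm (K r) \<le> M * (2 * pi - 0)"
    unfolding K_def using r
    by (intro integral_bound contk) (auto simp: k_def norm_cscale_cis[OF J] intro!: M p)
  ultimately have "2 * pi * (r * norm (f' z0)) \<le> 2 * pi * M"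
    using r by (simp add: mult_ac)
  then show ?thesis by (simp add: mult_le_cancel_left_pos)
qed

section \<open>Smoothing by analytic semigroups\<close>

text \<open>\<open>Arg\<close> is continuous at 1 and invariant under positive scaling, so a small
  disc about 1 inside the sector scales to discs about every \<open>t > 0\<close> with radius
  proportional to \<open>t\<close>.\<close>

lemma sector_cone:
  assumes "0 < \<delta>"
  obtains c where "0 < c" "c < 1" "\<And>t z. 0 < t \<Longrightarrow> norm (z - of_real t) \<le> c * t \<Longrightarrow> z \<in> sector \<delta>"
proof -
  have "continuous (at 1) Arg" by (rule continuous_at_Arg) simp
  then obtain d where d: "0 < d" "\<And>w. dist w 1 < d \<Longrightarrow> dist (Arg w) (Arg 1) < \<delta>"
    using assms unfolding continuous_at_eps_delta by blast
  define c where "c = min d 1 / 2"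
  have c: "0 < c" "c < 1" "c < d" using d(1) by (auto simp: c_def)
  have "z \<in> sector \<delta>" if t: "0 < t" and z: "norm (z - of_real t) \<le> c * t" for t z
  proof -
    have "z \<noteq> 0" using t z c by (auto simp: mult_less_cancel_right2)
    have "norm (z / of_real t - 1) = norm (z - of_real t) / t"
      using t by (simp add: divide_simps flip: norm_divide) (simp add: norm_divide)
    also have "\<dots> < d" using t z c by (simp add: divide_simps) (smt (verit) mult_strict_right_mono)
    finally have "\<bar>Arg (z / of_real t)\<bar> < \<delta>"
      using d(2)[of "z / of_real t"] by (simp add: dist_norm)
    then show ?thesis using t \<open>z \<noteq> 0\<close> by (simp add: sector_def)
  qed
  then show ?thesis using c that by blast
qed

context semigroup_generator
begin

text \<open>Cauchy's estimate for an orbit on a disc of radius proportional to \<open>t\<close>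
  about \<open>t\<close> bounds its complex derivative by a multiple of \<open>1 / t\<close>; on the
  real axis this derivative is the generator applied to the orbit, which also proves
  \<open>T t x \<in> D\<close>.\<close>

lemma analytic_estimate:
  assumes J: "cstruct J" and an: "bounded_analytic_sg J T"
  obtains M where "0 \<le> M" and "\<And>t x. 0 \<le> t \<Longrightarrow> norm (T t x) \<le> M * norm x"
    and "\<And>t x. 0 < t \<Longrightarrow> T t x \<in> D" and "\<And>t x. 0 < t \<Longrightarrow> t * norm (A (T t x)) \<le> M * norm x"
proof -
  obtain \<delta> U where \<delta>: "0 < \<delta>" and U: "\<forall>t>0. U (complex_of_real t) = T t"
    "\<forall>z\<in>sector \<delta>. bounded_linear (U z)"
    "\<forall>z1\<in>sector \<delta>. \<forall>z2\<in>sector \<delta>. U (z1 + z2) = U z1 \<circ> U z2"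
    "\<forall>x. hol_on J (sector \<delta>) (\<lambda>z. U z x)"
    "\<forall>\<delta>'. 0 < \<delta>' \<and> \<delta>' < \<delta> \<longrightarrow>
      (\<exists>M. \<forall>z\<in>sector \<delta>'. onorm (U z) \<le> M) \<and> (\<forall>x. ((\<lambda>z. U z x) \<longlongrightarrow> x) (at 0 within sector \<delta>'))"
    using an unfolding bounded_analytic_sg_def by - (elim exE conjE, rule that)
  note U_real = U(1)[rule_format] and U_bl = U(2)[rule_format] and U_add = U(3)[rule_format]
    and U_hol = U(4)[rule_format] and U_bd = U(5)[rule_format, THEN conjunct1]
  \<comment> \<open>Boundedness is provided only on strictly smaller sectors; half the angle is
    enough.\<close>
  obtain M0 where M0: "\<And>z. z \<in> sector (\<delta> / 2) \<Longrightarrow> onorm (U z) \<le> M0"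
    using U_bd[of "\<delta> / 2"] \<delta> by auto
  have sub: "z \<in> sector \<delta>" if "z \<in> sector (\<delta> / 2)" for z
    using that \<delta> by (simp add: sector_def)
  have U_norm: "norm (U z x) \<le> M0 * norm x" if "z \<in> sector (\<delta> / 2)" for z x
    using onorm[OF U_bl[OF sub[OF that]], of x] M0[OF that] by (meson mult_right_mono norm_ge_zero order_trans)
  obtain c where c: "0 < c" "c < 1"
    and cone: "\<And>t z. 0 < t \<Longrightarrow> norm (z - of_real t) \<le> c * t \<Longrightarrow> z \<in> sector (\<delta> / 2)"
    using sector_cone[of "\<delta> / 2"] \<delta> by auto
  have cone_real: "of_real t \<in> sector (\<delta> / 2)" if "0 < t" for t
    using cone[of t "of_real t"] that c by simp
  have deriv: "T t x \<in> D \<and> t * norm (A (T t x)) \<le> 2 * M0 / c * norm x" if t: "0 < t" for t x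
  proof -
    obtain f' where f': "\<And>z. z \<in> sector \<delta> \<Longrightarrow> ((\<lambda>z. U z x) has_derivative (\<lambda>h. cscale J h (f' z))) (at z)"
      using U_hol[of x] unfolding hol_on_def by metis
    \<comment> \<open>Half of the radius available from \<open>cone\<close>, so that
      \<open>z - z1\<close> stays in the sector after the further translation by \<open>z1\<close>,
      which has length \<open>r\<close>.\<close>
    define r where "r = c / 2 * t"
    have r: "0 < r" using c t by (simp add: r_def)
    define z1 where "z1 = complex_of_real r"
    have z1: "z1 \<in> sector (\<delta> / 2)" unfolding z1_def using r by (rule cone_real)
    have in_sector: "z \<in> sector (\<delta> / 2)" "z - z1 \<in> sector (\<delta> / 2)" if z: "z \<in> cball (of_real t) r" for z
    proof -
      have n: "norm (z - of_real t) \<le> r" using z by (simp add: dist_norm norm_minus_commute)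
      then show "z \<in> sector (\<delta> / 2)"
        using cone[OF t, of z] r by (simp add: r_def)
      have "norm ((z - of_real t) - z1) \<le> r + r"
        by (rule order_trans[OF norm_triangle_ineq4 add_mono[OF n]]) (use r in \<open>simp add: z1_def\<close>)
      then show "z - z1 \<in> sector (\<delta> / 2)"
        using cone[OF t, of "z - z1"] by (simp add: r_def algebra_simps)
    qed
    \<comment> \<open>The Cauchy estimate asks for a continuous derivative, whereas analyticity
      gives only a derivative at each point. The semigroup law expresses it as an orbit of the fixed
      vector \<open>f' z1\<close>, and orbits are continuous.\<close>
    have f'_eq: "f' z = U (z - z1) (f' z1)" if z: "z \<in> cball (of_real t) r" for z
    proof -
      note s = in_sector[OF z]
      have "((\<lambda>w. U (w + (z - z1)) x) has_derivative (\<lambda>h. cscale J h (f' z))) (at z1)"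
        by (rule has_derivative_compose[of "\<lambda>w. w + (z - z1)" "\<lambda>h. h", OF _ f'[THEN has_derivative_eq_rhs]])
          (use sub[OF s(1)] in \<open>auto intro!: derivative_eq_intros\<close>)
      moreover have "((\<lambda>w. U (w + (z - z1)) x) has_derivative (\<lambda>h. U (z - z1) (cscale J h (f' z1)))) (at z1)"
      proof (rule has_derivative_transform_within_open)
        show "((\<lambda>w. U (z - z1) (U w x)) has_derivative (\<lambda>h. U (z - z1) (cscale J h (f' z1)))) (at z1)"
          by (intro bounded_linear.has_derivative[OF U_bl] f' sub s z1)
        show "open (ball z1 (c * r))" "z1 \<in> ball z1 (c * r)" using c r by auto
        fix w assume "w \<in> ball z1 (c * r)"
        then have "norm (w - of_real r) \<le> c * r"
          by (simp add: z1_def dist_norm norm_minus_commute)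
        then have "w \<in> sector (\<delta> / 2)" by (rule cone[OF r])
        then show "U (z - z1) (U w x) = U (w + (z - z1)) x"
          using U_add[of "z - z1" w] sub s by (simp add: add.commute)
      qed
      ultimately have "(\<lambda>h. cscale J h (f' z)) = (\<lambda>h. U (z - z1) (cscale J h (f' z1)))"
        by (rule has_derivative_unique)
      from fun_cong[OF this, of 1] show ?thesis by simp
    qed
    have "continuous_on (sector \<delta>) (\<lambda>z. U z v)" for v
      using U_hol[of v] unfolding hol_on_def
      by (intro continuous_at_imp_continuous_on ballI) (blast intro: has_derivative_continuous)
    then have "continuous_on (cball (of_real t) r) (\<lambda>z. U (z - z1) (f' z1))"
      by (rule continuous_on_compose2) (intro continuous_intros, use sub in_sector(2) in blast)
    then have cf': "continuous_on (cball (of_real t) r) f'"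
      by (rule continuous_on_cong[THEN iffD1, rotated -1]) (simp_all add: f'_eq)
    have "r * norm (f' (of_real t)) \<le> M0 * norm x"
      by (rule Cauchy_estimate[OF J r f' cf' U_norm]) (use sub in_sector(1) in blast)+
    then have est: "t * norm (f' (of_real t)) \<le> 2 * M0 / c * norm x"
      using c by (simp add: r_def field_simps)
    have "((\<lambda>s. U (of_real s) x) has_derivative (\<lambda>h. cscale J (of_real h) (f' (of_real t)))) (at t)"
      by (rule has_derivative_compose[OF _ f']) (auto intro!: derivative_eq_intros sub cone_real t)
    then have "((\<lambda>s. U (of_real s) x) has_vector_derivative f' (of_real t)) (at t)"
      by (simp add: has_vector_derivative_def)
    then have "((\<lambda>s. T s x) has_vector_derivative f' (of_real t)) (at t)"
      by (rule has_vector_derivative_transform_within_open[of _ _ _ "{0<..}"]) (use t U_real in auto)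
    then have "((\<lambda>s. T s x) has_vector_derivative f' (of_real t)) (at_right t)"
      by (rule has_vector_derivative_at_within)
    then have "((\<lambda>h. inverse h *\<^sub>R (T (h + t) x - T t x)) \<longlongrightarrow> f' (of_real t)) (at_right 0)"
      unfolding has_vector_derivative_quotient by (simp add: filterlim_at_right_to_0[of _ _ t])
    then have "((\<lambda>h. inverse h *\<^sub>R (T h (T t x) - T t x)) \<longlongrightarrow> f' (of_real t)) (at_right 0)"
      by (rule Lim_transform_eventually) (auto intro!: eventually_at_right_0 simp: T_add less_imp_le[OF t])
    then show ?thesis using est unfolding generator_iff by simp
  qed
  \<comment> \<open>The lower bound 1 covers \<open>t = 0\<close>, where the semigroup is the
    identity.\<close>
  define M where "M = max 1 (max M0 (2 * M0 / c))"
  have M: "1 \<le> M" "M0 \<le> M" "2 * M0 / c \<le> M" by (auto simp: M_def)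
  have "norm (T t x) \<le> M * norm x" if t: "0 \<le> t" for t x
  proof (cases "t = 0")
    case True
    then show ?thesis using mult_right_mono[OF M(1), of "norm x"] by simp
  next
    case False
    then have "norm (T t x) \<le> M0 * norm x"
      using U_norm[OF cone_real, of t x] U_real[of t] t by simp
    then show ?thesis using mult_right_mono[OF M(2), of "norm x"] by simp
  qed
  moreover have "t * norm (A (T t x)) \<le> M * norm x" if "0 < t" for t x
    using deriv[OF that, of x] mult_right_mono[OF M(3), of "norm x"] by simp
  ultimately show ?thesis
    using M(1) deriv by (intro that[of M]) auto
qed

end

section \<open>Fractional domains and Balakrishnan's integral\<close>

text \<open>The majorant for Balakrishnan's integral: the first power is integrable at 0 because
  \<open>\<gamma> < 1\<close>, the second at infinity because \<open>0 < \<gamma>\<close>.\<close>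

lemma has_integral_powr_min:
  fixes a K1 K2 \<gamma> :: real
  assumes a: "0 < a" and \<gamma>: "0 < \<gamma>" "\<gamma> < 1"
  shows "((\<lambda>l. (if l \<in> {0<..a} then K1 * l powr (- \<gamma>) else 0) + (if l \<in> {a..} then K2 * l powr (- \<gamma> - 1) else 0))
    has_integral K1 * (a powr (1 - \<gamma>) / (1 - \<gamma>)) + K2 * (a powr (- \<gamma>) / \<gamma>)) {0<..}"
proof (rule has_integral_add)
  have "((\<lambda>l. K1 * l powr (- \<gamma>)) has_integral K1 * (a powr (1 - \<gamma>) / (1 - \<gamma>))) {0..a}"
    using has_integral_mult_right[OF has_integral_powr_from_0[of "- \<gamma>" a], of K1] a \<gamma> by simp
  then have "((\<lambda>l. K1 * l powr (- \<gamma>)) has_integral K1 * (a powr (1 - \<gamma>) / (1 - \<gamma>))) {0<..a}"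
    by (rule has_integral_spike_set_eq[THEN iffD1, rotated -1]) (auto intro: negligible_subset[of "{0}"])
  then show "((\<lambda>l. if l \<in> {0<..a} then K1 * l powr (- \<gamma>) else 0) has_integral K1 * (a powr (1 - \<gamma>) / (1 - \<gamma>))) {0<..}"
    by (subst has_integral_restrict) auto
  have "((\<lambda>l. K2 * l powr (- \<gamma> - 1)) has_integral K2 * (a powr (- \<gamma>) / \<gamma>)) {a..}"
    using has_integral_mult_right[OF has_integral_powr_to_inf[of "- \<gamma> - 1" a], of K2] a \<gamma> by simp
  then show "((\<lambda>l. if l \<in> {a..} then K2 * l powr (- \<gamma> - 1) else 0) has_integral K2 * (a powr (- \<gamma>) / \<gamma>)) {0<..}"
    using a by (subst has_integral_restrict) auto
qed

locale analytic_semigroup_generator = bounded_semigroup_generator +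
  assumes smoothing: "0 < t \<Longrightarrow> T t x \<in> D"
    and smoothing_bound: "0 < t \<Longrightarrow> t * norm (A (T t x)) \<le> M * norm x"
    and closed: "(\<And>n::nat. u n \<in> D) \<Longrightarrow> u \<longlonglongrightarrow> x \<Longrightarrow> (\<lambda>n. A (u n)) \<longlonglongrightarrow> y \<Longrightarrow> x \<in> D \<and> A x = y"
begin

lemma AT_bound: "0 < t \<Longrightarrow> norm (A (T t x)) \<le> M / t * norm x"
  using smoothing_bound[of t x] by (simp add: field_simps)

lemma AT_bounded_linear:
  assumes "0 < t"
  shows "bounded_linear (\<lambda>x. A (T t x))"
proof (rule bounded_linear_intro)
  show "norm (A (T t x)) \<le> norm x * (M / t)" for x
    using AT_bound[OF assms] by (simp add: mult.commute)
qed (use assms in \<open>auto simp: linear_simps[OF bl] generator_add generator_scale smoothing\<close>)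

lemma resolvent_in: "0 < l \<Longrightarrow> resolvent D A l x \<in> D"
  and resolvent_eq: "0 < l \<Longrightarrow> l *\<^sub>R resolvent D A l x - A (resolvent D A l x) = x"
  and resolvent_bound: "0 < l \<Longrightarrow> l * norm (resolvent D A l x) \<le> M * norm x"
proof -
  assume l: "0 < l"
  have "x \<in> (\<lambda>v. l *\<^sub>R v - A v) ` D"
    using resolvent_bij[OF _ l] closed unfolding bij_betw_def by blast
  then show *: "resolvent D A l x \<in> D" "l *\<^sub>R resolvent D A l x - A (resolvent D A l x) = x"
    unfolding resolvent_def by (rule inv_into_into, rule f_inv_into_f)
  then show "l * norm (resolvent D A l x) \<le> M * norm x"
    using resolvent_estimate[OF _ l] by metis
qed

text \<open>The first bound moves \<open>A\<close> onto the resolvent and is uniform in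
  \<open>l\<close>; the second leaves \<open>A\<close> on the semigroup and decays in
  \<open>l\<close>. Up to constants they cross at \<open>l = 1 / t\<close>, where the integral is
  split.\<close>

lemma AT_resolvent_bound:
  assumes t: "0 < t" and l: "0 < l"
  shows "norm (A (T t (resolvent D A l x))) \<le> M * (M + 1) * norm x"
    and "norm (A (T t (resolvent D A l x))) \<le> M * M * norm x / (t * l)"
proof -
  let ?u = "resolvent D A l x"
  have "A ?u = l *\<^sub>R ?u - x" using resolvent_eq[OF l, of x] by (simp add: algebra_simps)
  then have "A (T t ?u) = T t (l *\<^sub>R ?u - x)"
    using generator_semigroup[OF resolvent_in[OF l], of t x] t by simp
  also have "norm \<dots> \<le> M * norm (l *\<^sub>R ?u - x)"
    using bound t by simp
  also have "\<dots> \<le> M * (M * norm x + norm x)"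
  proof -
    have "norm (l *\<^sub>R ?u - x) \<le> M * norm x + norm x"
      using norm_triangle_ineq4[of "l *\<^sub>R ?u" x] resolvent_bound[OF l, of x] l by simp
    then show ?thesis using M_nonneg by (rule mult_left_mono)
  qed
  finally show "norm (A (T t ?u)) \<le> M * (M + 1) * norm x" by (simp add: algebra_simps)
  have "l * (t * norm (A (T t ?u))) \<le> l * (M * norm ?u)"
    using smoothing_bound[OF t] l by (intro mult_left_mono) auto
  also have "\<dots> = M * (l * norm ?u)" by simp
  also have "\<dots> \<le> M * (M * norm x)"
    using resolvent_bound[OF l, of x] M_nonneg by (rule mult_left_mono)
  finally show "norm (A (T t ?u)) \<le> M * M * norm x / (t * l)"
    using t l by (simp add: field_simps)
qed

text \<open>For \<gamma> strictly between 0 and 1 the constant depends on the preimage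
  \<open>w\<close> of \<open>x\<close> under the negative power, hence on \<open>x\<close> in an
  uncontrolled way; uniformity is restored afterwards.\<close>

lemma frac_dom_estimate:
  assumes \<gamma>: "0 \<le> \<gamma>" "\<gamma> \<le> 1" and x: "x \<in> frac_dom D A \<gamma>"
  shows "\<exists>K. \<forall>t>0. norm (A (T t x)) \<le> K * t powr (\<gamma> - 1)"
proof -
  consider "\<gamma> = 0" | "\<gamma> = 1" | "0 < \<gamma>" "\<gamma> < 1" using \<gamma> by linarith
  then show ?thesis
  proof cases
    case 1
    have "norm (A (T t x)) \<le> (M * norm x) * t powr (\<gamma> - 1)" if "0 < t" for t
      using AT_bound[OF that, of x] that 1 by (simp add: powr_minus_divide)
    then show ?thesis by blast
  next
    case 2
    then have "x \<in> D" using x by (simp add: frac_dom_def)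
    then have "norm (A (T t x)) \<le> (M * norm (A x)) * t powr (\<gamma> - 1)" if "0 < t" for t
      using bound[of t "A x"] that 2 by (simp add: generator_semigroup)
    then show ?thesis by blast
  next
    case 3
    then obtain w where "x = neg_frac_pow D A \<gamma> w"
      using x by (auto simp: frac_dom_def)
    define F where "F = (\<lambda>l. l powr (- \<gamma>) *\<^sub>R resolvent D A l w)"
    define s where "s = sin (pi * \<gamma>) / pi"
    have xF: "x = s *\<^sub>R integral {0<..} F"
      by (simp add: \<open>x = _\<close> neg_frac_pow_def F_def s_def)
    define K1 where "K1 = M * (M + 1) * norm w"
    define K2 where "K2 = M * M * norm w"
    have "norm (A (T t x)) \<le> \<bar>s\<bar> * (K1 / (1 - \<gamma>) + K2 / \<gamma>) * t powr (\<gamma> - 1)" if t: "0 < t" for t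
    proof -
      \<comment> \<open>\<open>A\<close> alone cannot be moved under the integral as a bounded
        operator, but its composition with \<open>T t\<close> can.\<close>
      define G where "G = (\<lambda>x. A (T t x))"
      have G: "bounded_linear G" unfolding G_def by (rule AT_bounded_linear[OF t])
      define g where "g = (\<lambda>l. (if l \<in> {0<..1/t} then K1 * l powr (- \<gamma>) else 0)
        + (if l \<in> {1/t..} then K2 / t * l powr (- \<gamma> - 1) else 0))"
      \<comment> \<open>At \<open>t = l = 1\<close> both constants bound a norm.\<close>
      have K: "0 \<le> K1" "0 \<le> K2"
        using order_trans[OF norm_ge_zero AT_resolvent_bound(1)[of 1 1 w]]
          order_trans[OF norm_ge_zero AT_resolvent_bound(2)[of 1 1 w]] by (auto simp: K1_def K2_def)
      have GF: "norm (G (F l)) \<le> g l" if l: "l \<in> {0<..}" for l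
      proof -
        have l: "0 < l" using l by simp
        have "norm (G (F l)) = l powr (- \<gamma>) * norm (A (T t (resolvent D A l w)))"
          by (simp add: F_def linear_simps[OF G]) (simp add: G_def)
        moreover have "l powr (- \<gamma>) * norm (A (T t (resolvent D A l w))) \<le> l powr (- \<gamma>) * K1"
          using AT_resolvent_bound(1)[OF t l, of w] by (intro mult_left_mono) (auto simp: K1_def)
        moreover have "l powr (- \<gamma>) * norm (A (T t (resolvent D A l w))) \<le> l powr (- \<gamma>) * (K2 / (t * l))"
          using AT_resolvent_bound(2)[OF t l, of w] by (intro mult_left_mono) (auto simp: K2_def)
        moreover have "l powr (- \<gamma>) * (K2 / (t * l)) = K2 / t * l powr (- \<gamma> - 1)"
          using l t by (simp add: powr_diff field_simps)
        moreover have "0 \<le> K2 / t * l powr (- \<gamma> - 1)" "0 \<le> K1 * l powr (- \<gamma>)"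
          using K t by auto
        ultimately show ?thesis
          using l by (auto simp: g_def mult.commute)
      qed
      have g: "(g has_integral K1 * ((1/t) powr (1 - \<gamma>) / (1 - \<gamma>)) + K2 / t * ((1/t) powr (- \<gamma>) / \<gamma>)) {0<..}"
        unfolding g_def using t 3 by (intro has_integral_powr_min) auto
      have p: "(1/t) powr (1 - \<gamma>) = t powr (\<gamma> - 1)" "(1/t) powr (- \<gamma>) / t = t powr (\<gamma> - 1)"
        using t by (simp_all add: powr_divide powr_diff powr_minus field_simps)
      have "norm (G (integral {0<..} F)) \<le> (K1 / (1 - \<gamma>) + K2 / \<gamma>) * t powr (\<gamma> - 1)"
      proof (cases "F integrable_on {0<..}")
        case True
        have "norm (integral {0<..} (G \<circ> F)) \<le> integral {0<..} g"
          using integrable_linear[OF True G] g GF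
          by (intro integral_norm_bound_integral) (auto simp: has_integral_iff)
        also have "integral {0<..} g = (K1 / (1 - \<gamma>) + K2 / \<gamma>) * t powr (\<gamma> - 1)"
          using integral_unique[OF g] by (simp add: p(1) p(2)[symmetric] algebra_simps)
        finally show ?thesis using integral_linear[OF True G] by simp
      next
        \<comment> \<open>The integral then has the default value 0 and the estimate is trivial, so
          integrability of Balakrishnan's integrand never has to be shown.\<close>
        case False
        then show ?thesis
          using K 3 by (simp add: not_integrable_integral linear_simps[OF G])
      qed
      then have "\<bar>s\<bar> * norm (G (integral {0<..} F)) \<le> \<bar>s\<bar> * ((K1 / (1 - \<gamma>) + K2 / \<gamma>) * t powr (\<gamma> - 1))"
        by (intro mult_left_mono) auto
      moreover have "norm (A (T t x)) = \<bar>s\<bar> * norm (G (integral {0<..} F))"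
        using linear_simps(5)[OF G, of s] by (simp add: xF G_def)
      ultimately show ?thesis by (simp add: mult.assoc)
    qed
    then show ?thesis by blast
  qed
qed

text \<open>Multiplication by \<open>t powr (1 - \<gamma>)\<close> turns the pointwise estimates
  into pointwise boundedness of one family of bounded operators indexed by all \<open>t > 0\<close>,
  to which Banach--Steinhaus applies.\<close>

lemma frac_range_estimate:
  fixes R :: "'b::banach \<Rightarrow> 'a"
  assumes \<gamma>: "0 \<le> \<gamma>" "\<gamma> \<le> 1" and R: "bounded_linear R" "range R \<subseteq> frac_dom D A \<gamma>"
  obtains K where "0 \<le> K" "\<And>t y. 0 < t \<Longrightarrow> norm (A (T t (R y))) \<le> K * t powr (\<gamma> - 1) * norm y"
proof (rule uniform_boundedness[of "{0<..}" "\<lambda>t y. t powr (1 - \<gamma>) *\<^sub>R A (T t (R y))"])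
  fix t :: real assume "t \<in> {0<..}"
  then show "bounded_linear (\<lambda>y. t powr (1 - \<gamma>) *\<^sub>R A (T t (R y)))"
    by (intro bounded_linear_const_scaleR bounded_linear_compose[OF AT_bounded_linear R(1)]) simp
next
  fix y
  obtain K where K: "\<And>t. 0 < t \<Longrightarrow> norm (A (T t (R y))) \<le> K * t powr (\<gamma> - 1)"
    using frac_dom_estimate[OF \<gamma>, of "R y"] R(2) by auto
  have "norm (t powr (1 - \<gamma>) *\<^sub>R A (T t (R y))) \<le> K" if t: "0 < t" for t
  proof -
    have "t powr (1 - \<gamma>) * norm (A (T t (R y))) \<le> t powr (1 - \<gamma>) * (K * t powr (\<gamma> - 1))"
      by (intro mult_left_mono K t) auto
    also have "\<dots> = K" using t by (simp flip: powr_add)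
    finally show ?thesis by simp
  qed
  then show "\<exists>M. \<forall>t\<in>{0<..}. norm (t powr (1 - \<gamma>) *\<^sub>R A (T t (R y))) \<le> M" by auto
next
  fix K assume K: "0 \<le> K" "\<And>t y. t \<in> {0<..} \<Longrightarrow> norm (t powr (1 - \<gamma>) *\<^sub>R A (T t (R y))) \<le> K * norm y"
  have "norm (A (T t (R y))) \<le> K * t powr (\<gamma> - 1) * norm y" if t: "0 < t" for t y
  proof -
    have "norm (A (T t (R y))) = t powr (\<gamma> - 1) * (t powr (1 - \<gamma>) * norm (A (T t (R y))))"
      using t by (simp flip: mult.assoc powr_add)
    also have "\<dots> \<le> t powr (\<gamma> - 1) * (K * norm y)"
      using K(2)[of t y] t by (intro mult_left_mono) auto
    finally show ?thesis by (simp add: mult_ac)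
  qed
  then show ?thesis using K(1) that by blast
qed

end

section \<open>Quadrature and summation\<close>

text \<open>After subtraction of the tangent at the midpoint the integrand is at most
  \<open>K * \<tau>\<^sup>2\<close>, and the tangent's linear part does not contribute. The crude
  constant 1 instead of 1/24 suffices.\<close>

lemma midpoint_rule_error:
  fixes G :: "real \<Rightarrow> 'a::banach"
  assumes \<tau>: "0 \<le> \<tau>"
    and G: "\<And>s. s \<in> {0..\<tau>} \<Longrightarrow> (G has_vector_derivative G' s) (at s within {0..\<tau>})"
    and G': "\<And>s. s \<in> {0..\<tau>} \<Longrightarrow> (G' has_vector_derivative G'' s) (at s within {0..\<tau>})"
    and K: "\<And>s. s \<in> {0..\<tau>} \<Longrightarrow> norm (G'' s) \<le> K"
  shows "norm (integral {0..\<tau>} G - \<tau> *\<^sub>R G (\<tau> / 2)) \<le> K * \<tau> ^ 3"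
proof -
  define m where "m = \<tau> / 2"
  have m: "m \<in> {0..\<tau>}" using \<tau> by (simp add: m_def)
  have K0: "0 \<le> K" using order_trans[OF norm_ge_zero K[OF m]] .
  have dist: "norm (s - m) \<le> \<tau>" if "s \<in> {0..\<tau>}" for s
    using that \<tau> by (auto simp: m_def)
  have d: "norm (G' s - G' m) \<le> K * \<tau>" if s: "s \<in> {0..\<tau>}" for s
  proof -
    have "norm (G' s - G' m) \<le> K * norm (s - m)"
      by (rule differentiable_bound[OF _ G'[unfolded has_vector_derivative_def]])
        (use s m K in \<open>auto intro!: onorm_le simp: mult.commute[of K] mult_left_mono\<close>)
    also have "\<dots> \<le> K * \<tau>" using dist[OF s] K0 by (rule mult_left_mono)
    finally show ?thesis .
  qed
  define E where "E = (\<lambda>s. G s - G m - (s - m) *\<^sub>R G' m)"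
  have E: "norm (E s) \<le> K * \<tau>\<^sup>2" if s: "s \<in> {0..\<tau>}" for s
  proof -
    have "norm (E s) \<le> norm (s - m) * (K * \<tau>)"
      unfolding E_def using d s m
      by (intro vector_differentiable_bound_linearization[where S="{0..\<tau>}"] G)
        (auto simp: closed_segment_eq_real_ivl)
    also have "\<dots> \<le> \<tau> * (K * \<tau>)"
      using dist[OF s] K0 \<tau> by (intro mult_right_mono) auto
    finally show ?thesis by (simp add: power2_eq_square mult_ac)
  qed
  have cG: "continuous_on {0..\<tau>} G"
    unfolding continuous_on_eq_continuous_within
    using has_vector_derivative_continuous[OF G] by blast
  \<comment> \<open>By symmetry about the midpoint the linear term integrates to 0; this gains the
    third power of \<tau>.\<close>
  have "((\<lambda>s. s - m) has_integral (\<tau> - m)\<^sup>2 / 2 - (0 - m)\<^sup>2 / 2) {0..\<tau>}"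
    using \<tau> by (intro fundamental_theorem_of_calculus)
      (auto intro!: derivative_eq_intros simp flip: has_real_derivative_iff_has_vector_derivative)
  then have "((\<lambda>s. s - m) has_integral 0) {0..\<tau>}"
    by (simp add: m_def power2_eq_square)
  from has_integral_scaleR_left[OF this, of "G' m"]
  have "((\<lambda>s. (s - m) *\<^sub>R G' m) has_integral 0) {0..\<tau>}" by simp
  moreover have "(G has_integral integral {0..\<tau>} G) {0..\<tau>}"
    using cG by (intro integrable_integral integrable_continuous_real)
  ultimately have "(E has_integral integral {0..\<tau>} G - (\<tau> - 0) *\<^sub>R G m - 0) {0..\<tau>}"
    unfolding E_def using \<tau> has_integral_const_real[of "G m" 0 \<tau>] by (intro has_integral_diff) simp_all
  then have "integral {0..\<tau>} E = integral {0..\<tau>} G - \<tau> *\<^sub>R G m"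
    by (simp add: integral_unique)
  moreover have "norm (integral {0..\<tau>} E) \<le> K * \<tau>\<^sup>2 * (\<tau> - 0)"
    using E \<tau> unfolding E_def by (intro integral_bound continuous_intros cG) auto
  ultimately show ?thesis by (simp add: m_def power2_eq_square power3_eq_cube mult_ac)
qed

lemma integral_equal_pieces:
  fixes f :: "real \<Rightarrow> 'a::banach"
  assumes "0 \<le> \<tau>" "continuous_on {0..real n * \<tau>} f"
  shows "integral {0..real n * \<tau>} f = (\<Sum>j<n. integral {0..\<tau>} (\<lambda>s. f (real j * \<tau> + s)))"
  using assms(2)
proof (induction n)
  case (Suc n)
  have n: "0 \<le> real n * \<tau>" "real n * \<tau> \<le> real (Suc n) * \<tau>"
    using assms(1) by (auto intro: mult_right_mono)
  have "integral {0..real (Suc n) * \<tau>} f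
      = integral {0..real n * \<tau>} f + integral {real n * \<tau>..real (Suc n) * \<tau>} f"
    using Henstock_Kurzweil_Integration.integral_combine[OF n integrable_continuous_real[OF Suc.prems]] by simp
  also have "integral {0..real n * \<tau>} f = (\<Sum>j<n. integral {0..\<tau>} (\<lambda>s. f (real j * \<tau> + s)))"
    using n by (intro Suc.IH continuous_on_subset[OF Suc.prems]) auto
  also have "integral {real n * \<tau>..real (Suc n) * \<tau>} f = integral {0..\<tau>} (\<lambda>s. f (real n * \<tau> + s))"
    using integral_shift_Icc_real[of 0 \<tau> f "real n * \<tau>"] by (simp add: o_def algebra_simps)
  finally show ?case by simp
qed simp

text \<open>The maximum gives the endpoint step \<open>k = 0\<close> weight 1. The sum is at most
  \<open>2 + ln n\<close>, which is below \<open>4 * ln n\<close> exactly when \<open>ln n\<close>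
  is at least 2/3; \<open>ln 2\<close> already is.\<close>

lemma sum_inverse_le_ln:
  assumes "2 \<le> n"
  shows "(\<Sum>k<n. 1 / real (max 1 k)) \<le> 4 * ln (real n)"
proof -
  have "(\<Sum>k<n. 1 / real (max 1 k)) = 1 + (\<Sum>k\<in>{1..<n}. 1 / real k)"
    using assms by (subst lessThan_atLeast0, subst sum.atLeast_Suc_lessThan) auto
  also have "(\<Sum>k\<in>{1..<n}. 1 / real k) \<le> (\<Sum>k\<in>{1..n}. 1 / real k)"
    by (intro sum_mono2) auto
  also have "\<dots> = harm n" by (simp add: harm_def inverse_eq_divide)
  also have "harm n \<le> 1 + ln (real n)"
    using decseqD[OF decseq_harm_diff_ln, of 0 "n - 1"] assms by (simp add: harm_def)
  also have "1 + (1 + ln (real n)) \<le> 4 * ln (real n)"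
  proof -
    have "ln 2 \<le> ln (real n)" using assms by (subst ln_le_cancel_iff) auto
    then show ?thesis using ln2_ge_two_thirds by linarith
  qed
  finally show ?thesis by simp
qed

section \<open>Derivatives of the convolution integrand\<close>

context analytic_semigroup_generator
begin

text \<open>Half of the time is spent on entering the domain: \<open>T (u / 2) x\<close> lies in
  \<open>D\<close>, and the orbit from there is differentiable.\<close>

lemma smooth_derivative:
  assumes u: "0 < u"
  shows "((\<lambda>u. T u x) has_vector_derivative A (T u x)) (at u)"
proof -
  define y where "y = T (u / 2) x"
  have y: "y \<in> D" using u by (simp add: y_def smoothing)
  have sh: "((\<lambda>r. r - u / 2) has_vector_derivative 1) (at u)"
    by (auto intro!: derivative_eq_intros)
  have "((\<lambda>s. T s y) has_vector_derivative T (u / 2) (A y)) (at (u - u / 2))"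
    using orbit_derivative_at[OF y, of "u / 2"] u by simp
  from vector_diff_chain_at[OF sh this]
  have "((\<lambda>r. T (r - u / 2) y) has_vector_derivative T (u / 2) (A y)) (at u)"
    by (simp add: o_def)
  then have "((\<lambda>r. T r x) has_vector_derivative T (u / 2) (A y)) (at u)"
    by (rule has_vector_derivative_transform_within_open[of _ _ _ "{u/2<..}"])
      (use u in \<open>auto simp: y_def simp flip: T_add\<close>)
  moreover have "T (u / 2) (A y) = A (T u x)"
    using generator_semigroup[OF y, of "u / 2"] u by (simp add: y_def flip: T_add)
  ultimately show ?thesis by simp
qed

lemma AT_split: "0 < u \<Longrightarrow> 0 < v \<Longrightarrow> A (T (u + v) x) = T u (A (T v x))"
  using generator_semigroup[OF smoothing, of v u x] by (simp add: T_add)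

lemma AT_derivative:
  assumes u: "0 < u"
  shows "((\<lambda>u. A (T u x)) has_vector_derivative A (A (T u x))) (at u)"
proof -
  define y where "y = A (T (u / 2) x)"
  have sh: "((\<lambda>r. r - u / 2) has_vector_derivative 1) (at u)"
    by (auto intro!: derivative_eq_intros)
  have "((\<lambda>s. T s y) has_vector_derivative A (T (u / 2) y)) (at (u - u / 2))"
    using smooth_derivative[of "u / 2" y] u by simp
  from vector_diff_chain_at[OF sh this]
  have "((\<lambda>r. T (r - u / 2) y) has_vector_derivative A (T (u / 2) y)) (at u)"
    by (simp add: o_def)
  then have "((\<lambda>r. A (T r x)) has_vector_derivative A (T (u / 2) y)) (at u)"
    by (rule has_vector_derivative_transform_within_open[of _ _ _ "{u/2<..}"])
      (use u in \<open>auto simp: y_def simp flip: AT_split\<close>)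
  then show ?thesis
    using AT_split[of "u / 2" "u / 2" x] u by (simp add: y_def)
qed

lemma reflected_derivative:
  assumes "(F has_vector_derivative F') (at (a - s))"
  shows "((\<lambda>r. F (a - r)) has_vector_derivative - F') (at s within X)"
proof -
  have "((\<lambda>r. a - r) has_vector_derivative - 1) (at s)"
    by (auto intro!: derivative_eq_intros)
  from vector_diff_chain_at[OF this assms] show ?thesis
    by (simp add: o_def has_vector_derivative_at_within)
qed

text \<open>The strict inequality \<open>\<tau> < a\<close> keeps the time argument above
  \<open>a - \<tau> > 0\<close>, so that \<open>A\<close> composed with the semigroup is uniformly
  bounded and the product rule applies a second time. The last splitting step, with
  \<open>a = \<tau>\<close>, is thereby excluded.\<close>

lemma convolution_derivative:
  assumes s: "s \<in> {0..\<tau>}" "\<tau> < a" and w: "(w has_vector_derivative w') (at s within {0..\<tau>})"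
  shows "((\<lambda>r. T (a - r) (w r)) has_vector_derivative T (a - s) w' - A (T (a - s) (w s))) (at s within {0..\<tau>})"
    and "((\<lambda>r. A (T (a - r) (w r))) has_vector_derivative A (T (a - s) w') - A (A (T (a - s) (w s)))) (at s within {0..\<tau>})"
proof -
  have u: "0 < a - s" using s by simp
  note d = reflected_derivative[OF smooth_derivative[OF u], of _ "{0..\<tau>}"]
    and d' = reflected_derivative[OF AT_derivative[OF u], of _ "{0..\<tau>}"]
  have "((\<lambda>r. T (a - r) (w r)) has_vector_derivative - A (T (a - s) (w s)) + T (a - s) w') (at s within {0..\<tau>})"
  proof (rule strong_product_rule[where M=M, OF _ s(1) _ d _ w])
    show "((\<lambda>r. T (a - r) w') \<longlongrightarrow> T (a - s) w') (at s within {0..\<tau>})"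
      using has_vector_derivative_continuous[OF d[of w']] by (simp add: continuous_within)
  qed (use s bl bound in auto)
  then show "((\<lambda>r. T (a - r) (w r)) has_vector_derivative T (a - s) w' - A (T (a - s) (w s))) (at s within {0..\<tau>})"
    by simp
  have "((\<lambda>r. A (T (a - r) (w r))) has_vector_derivative - A (A (T (a - s) (w s))) + A (T (a - s) w')) (at s within {0..\<tau>})"
  proof (rule strong_product_rule[OF _ s(1) _ d' _ w])
    show "((\<lambda>r. A (T (a - r) w')) \<longlongrightarrow> A (T (a - s) w')) (at s within {0..\<tau>})"
      using has_vector_derivative_continuous[OF d'[of w']] by (simp add: continuous_within)
    fix r x assume r: "r \<in> {0..\<tau>}"
    show "norm (A (T (a - r) x)) \<le> M / (a - \<tau>) * norm x"
      using r s M_nonneg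
      by (intro order_trans[OF AT_bound[of "a - r" x]] mult_right_mono divide_left_mono) auto
  qed (use s AT_bounded_linear in auto)
  then show "((\<lambda>r. A (T (a - r) (w r))) has_vector_derivative A (T (a - s) w') - A (A (T (a - s) (w s)))) (at s within {0..\<tau>})"
    by simp
qed

text \<open>Includes the endpoint \<open>s = a\<close>, where smoothing is lost; strong continuity
  and the uniform bound still give continuity.\<close>

lemma convolution_continuous:
  assumes "continuous_on {0..a} w"
  shows "continuous_on {0..a} (\<lambda>s. T (a - s) (w s))"
  unfolding continuous_on_def
proof
  fix s assume s: "s \<in> {0..a}"
  have c: "continuous_on {0..a} (\<lambda>r. T (a - r) (w s))"
    by (rule continuous_on_compose2[OF cont]) (auto intro: continuous_intros)
  show "((\<lambda>r. T (a - r) (w r)) \<longlongrightarrow> T (a - s) (w s)) (at s within {0..a})"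
    by (rule strongly_bounded_tendsto[where M=M and x="w s", rotated 3])
      (use assms c s bl bound in \<open>auto simp: continuous_on_def\<close>)
qed

end

section \<open>Local errors of the splitting\<close>

text \<open>\<open>R\<close> stands for the operator \<open>D0\<close>; the error analysis sees it
  only through its norm bound and the singular estimate with constant \<open>K\<close>.\<close>

locale coupled_semigroups =
  analytic_semigroup_generator D A T M + Y: semigroup_generator DB B S
  for D :: "'e::banach set" and A T M and DB :: "'f::banach set" and B S +
  fixes R :: "'f \<Rightarrow> 'e" and \<gamma> K r :: real
  assumes \<gamma>: "0 \<le> \<gamma>" "\<gamma> \<le> 1"
    and R: "bounded_linear R"
    and r: "0 \<le> r" "\<And>y. norm (R y) \<le> r * norm y"
    and K: "0 \<le> K" "\<And>t y. 0 < t \<Longrightarrow> norm (A (T t (R y))) \<le> K * t powr (\<gamma> - 1) * norm y"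
begin

text \<open>Each half of the time \<open>u\<close> carries one factor \<open>A\<close>: the first
  contributes \<open>2 * M / u\<close>, the second \<open>K * (u / 2) powr (\<gamma> - 1)\<close>,
  which is at most twice its value at \<open>u\<close>.\<close>

lemma AAT_bound:
  assumes u: "0 < u"
  shows "norm (A (A (T u (R y)))) \<le> 4 * M * K * u powr (\<gamma> - 2) * norm y"
proof -
  have h: "(u / 2) powr (\<gamma> - 1) \<le> 2 * u powr (\<gamma> - 1)"
  proof -
    have "(u / 2) powr (\<gamma> - 1) = u powr (\<gamma> - 1) * 2 powr (1 - \<gamma>)"
      using u by (simp add: powr_divide powr_diff field_simps)
    also have "\<dots> \<le> u powr (\<gamma> - 1) * 2 powr 1"
      using \<gamma> by (intro mult_left_mono powr_mono) auto
    finally show ?thesis by (simp add: mult.commute)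
  qed
  have "norm (A (A (T u (R y)))) = norm (A (T (u / 2) (A (T (u / 2) (R y)))))"
    using AT_split[of "u / 2" "u / 2" "R y"] u by simp
  also have "\<dots> \<le> M / (u / 2) * norm (A (T (u / 2) (R y)))"
    using u by (intro AT_bound) simp
  also have "\<dots> \<le> M / (u / 2) * (K * (2 * u powr (\<gamma> - 1)) * norm y)"
    using u M_nonneg K(1) h
    by (intro mult_left_mono order_trans[OF K(2)] mult_right_mono) auto
  also have "\<dots> = 4 * M * K * u powr (\<gamma> - 2) * norm y"
    using u by (simp add: powr_diff power2_eq_square field_simps)
  finally show ?thesis .
qed

lemma coupled_orbit_derivative:
  assumes "v \<in> DB" "s \<in> {0..\<tau>}"
  shows "((\<lambda>s. R (S s v)) has_vector_derivative R (S s (B v))) (at s within {0..\<tau>})"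
proof (rule bounded_linear.has_vector_derivative[OF R])
  show "((\<lambda>s. S s v) has_vector_derivative S s (B v)) (at s within {0..\<tau>})"
    by (rule has_vector_derivative_within_subset[OF Y.orbit_derivative[OF assms(1)]]) (use assms(2) in auto)
qed

text \<open>On the step the time argument never falls below \<open>b = k * \<tau>\<close>. The
  second derivative has terms with zero, one (twice) and two factors \<open>A\<close>, whose rates
  are brought to \<open>b powr (\<gamma> - 2)\<close>; the three summands of the constant correspond
  to them.\<close>

lemma interior_step:
  assumes z: "z \<in> DB" "B z \<in> DB" and \<tau>: "0 < \<tau>" and k: "1 \<le> k" "k * \<tau> \<le> t0" "\<tau> \<le> t0"
    and N: "0 \<le> N" "\<And>s x. 0 \<le> s \<Longrightarrow> s \<le> t0 \<Longrightarrow> norm (S s x) \<le> N * norm x"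
  shows "norm (integral {0..\<tau>} (\<lambda>s. T ((k + 1) * \<tau> - s) (R (S s z))) - \<tau> *\<^sub>R T ((k + 1) * \<tau> - \<tau> / 2) (R (S (\<tau> / 2) z)))
    \<le> (4 * M * K + 2 * K * t0 + M * r * t0 powr (2 - \<gamma>)) * N * (\<tau> powr (1 + \<gamma>) / k) * (norm z + norm (B z) + norm (B (B z)))"
proof -
  define a where "a = (k + 1) * \<tau>"
  define b where "b = k * \<tau>"
  define Z where "Z = norm z + norm (B z) + norm (B (B z))"
  define C where "C = 4 * M * K + 2 * K * t0 + M * r * t0 powr (2 - \<gamma>)"
  have b: "0 < b" "b \<le> t0" and a: "a = b + \<tau>" "\<tau> < a"
    using \<tau> k by (auto simp: a_def b_def algebra_simps)
  have Z: "norm z \<le> Z" "norm (B z) \<le> Z" "norm (B (B z)) \<le> Z" by (auto simp: Z_def)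
  define w where "w = (\<lambda>v s. R (S s v))"
  have w': "(w v has_vector_derivative w (B v) s) (at s within {0..\<tau>})" if "v \<in> DB" "s \<in> {0..\<tau>}" for v s
    unfolding w_def by (rule coupled_orbit_derivative[OF that])
  have bound'': "norm (T (a - s) (w (B (B z)) s) - A (T (a - s) (w (B z) s))
      - (A (T (a - s) (w (B z) s)) - A (A (T (a - s) (w z s))))) \<le> b powr (\<gamma> - 2) * C * (N * Z)"
    if s: "s \<in> {0..\<tau>}" for s
  proof -
    have u: "b \<le> a - s" "0 < a - s" using s a b by auto
    have SN: "norm (S s v) \<le> N * Z" if "norm v \<le> Z" for v
      using N(2)[of s v] s k mult_left_mono[OF that N(1)] by auto
    have b1: "b powr (\<gamma> - 1) = b powr (\<gamma> - 2) * b" "b powr (\<gamma> - 2) * b powr (2 - \<gamma>) = 1"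
      using b by (simp_all add: powr_diff power2_eq_square field_simps)
    have "norm (T (a - s) (w (B (B z)) s)) \<le> M * (r * (N * Z))"
      unfolding w_def using u M_nonneg r(1)
      by (intro order_trans[OF bound] mult_left_mono order_trans[OF r(2)] SN Z) auto
    also have "\<dots> = b powr (\<gamma> - 2) * (M * r * b powr (2 - \<gamma>)) * (N * Z)"
      using b1(2) by (simp add: algebra_simps)
    also have "\<dots> \<le> b powr (\<gamma> - 2) * (M * r * t0 powr (2 - \<gamma>)) * (N * Z)"
      using b \<gamma> M_nonneg r(1) N(1)
      by (intro mult_right_mono mult_left_mono powr_mono2) (auto simp: Z_def)
    finally have 1: "norm (T (a - s) (w (B (B z)) s)) \<le> b powr (\<gamma> - 2) * (M * r * t0 powr (2 - \<gamma>)) * (N * Z)" .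
    have "norm (A (T (a - s) (w (B z) s))) \<le> K * (a - s) powr (\<gamma> - 1) * norm (S s (B z))"
      unfolding w_def using u by (intro K(2)) simp
    also have "\<dots> \<le> K * (b powr (\<gamma> - 2) * t0) * (N * Z)"
    proof (intro mult_mono order_refl)
      have "(a - s) powr (\<gamma> - 1) \<le> b powr (\<gamma> - 1)"
        using u b \<gamma> by (intro powr_mono2') auto
      also have "\<dots> \<le> b powr (\<gamma> - 2) * t0"
        unfolding b1(1) using b by (intro mult_left_mono) auto
      finally show "(a - s) powr (\<gamma> - 1) \<le> b powr (\<gamma> - 2) * t0" .
    qed (use K b SN Z in auto)
    finally have 2: "norm (A (T (a - s) (w (B z) s))) \<le> K * (b powr (\<gamma> - 2) * t0) * (N * Z)" .
    have "norm (A (A (T (a - s) (w z s)))) \<le> 4 * M * K * (a - s) powr (\<gamma> - 2) * norm (S s z)"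
      unfolding w_def using u by (intro AAT_bound) simp
    also have "\<dots> \<le> 4 * M * K * b powr (\<gamma> - 2) * (N * Z)"
      using u b \<gamma> K(1) M_nonneg SN[OF Z(1)]
      by (intro mult_mono powr_mono2') auto
    finally have 3: "norm (A (A (T (a - s) (w z s)))) \<le> 4 * M * K * b powr (\<gamma> - 2) * (N * Z)" .
    have tri: "norm (p - q - (q - v)) \<le> norm p + 2 * norm q + norm v" for p q v :: 'e
      using norm_triangle_ineq4[of "p - q" "q - v"] norm_triangle_ineq4[of p q] norm_triangle_ineq4[of q v] by simp
    show ?thesis
      using tri[of "T (a - s) (w (B (B z)) s)" "A (T (a - s) (w (B z) s))" "A (A (T (a - s) (w z s)))"] 1 2 3
      by (simp add: C_def algebra_simps)
  qed
  have "norm (integral {0..\<tau>} (\<lambda>s. T (a - s) (w z s)) - \<tau> *\<^sub>R T (a - \<tau> / 2) (w z (\<tau> / 2)))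
      \<le> b powr (\<gamma> - 2) * C * (N * Z) * \<tau> ^ 3"
  proof (rule midpoint_rule_error)
    fix s assume s: "s \<in> {0..\<tau>}"
    show "((\<lambda>s. T (a - s) (w z s)) has_vector_derivative T (a - s) (w (B z) s) - A (T (a - s) (w z s))) (at s within {0..\<tau>})"
      by (rule convolution_derivative(1)[OF s a(2) w'[OF z(1) s]])
    show "((\<lambda>s. T (a - s) (w (B z) s) - A (T (a - s) (w z s))) has_vector_derivative
        T (a - s) (w (B (B z)) s) - A (T (a - s) (w (B z) s)) - (A (T (a - s) (w (B z) s)) - A (A (T (a - s) (w z s)))))
        (at s within {0..\<tau>})"
      by (rule has_vector_derivative_diff[OF convolution_derivative(1)[OF s a(2) w'[OF z(2) s]]
            convolution_derivative(2)[OF s a(2) w'[OF z(1) s]]])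
  qed (use \<tau> bound'' in auto)
  also have "\<dots> = (b powr (\<gamma> - 2) * \<tau> ^ 3) * (C * N * Z)" by (simp add: mult_ac)
  also have "\<dots> \<le> (\<tau> powr (1 + \<gamma>) / k) * (C * N * Z)"
  proof (rule mult_right_mono)
    have "b powr (\<gamma> - 2) * \<tau> ^ 3 = k powr (\<gamma> - 2) * \<tau> powr (1 + \<gamma>)"
      using \<tau> k by (simp add: b_def powr_mult powr_diff powr_add powr_numeral field_simps power2_eq_square power3_eq_cube)
    \<comment> \<open>Uses \<open>\<gamma> \<le> 1\<close>, with equality at
      \<open>\<gamma> = 1\<close>; there the harmonic sum arises.\<close>
    also have "\<dots> \<le> k powr (- 1) * \<tau> powr (1 + \<gamma>)"
      using k \<gamma> by (intro mult_right_mono powr_mono) auto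
    also have "\<dots> = \<tau> powr (1 + \<gamma>) / k" using k by (simp add: powr_minus_divide)
    finally show "b powr (\<gamma> - 2) * \<tau> ^ 3 \<le> \<tau> powr (1 + \<gamma>) / k" .
    show "0 \<le> C * N * Z"
      using M_nonneg K(1) r(1) N(1) k \<tau> by (auto simp: C_def Z_def)
  qed
  finally show ?thesis by (simp add: a_def w_def C_def Z_def mult_ac)
qed

text \<open>For positive \<gamma> the constant comes from integrating
  \<open>K * t powr (\<gamma> - 1)\<close>. At \<open>\<gamma> = 0\<close> that integral diverges at
  0, and boundedness of the semigroup gives the constant instead.\<close>

definition hoelder :: real where
  "hoelder = (if \<gamma> = 0 then 2 * M * r else K / \<gamma>)"

lemma hoelder_nonneg: "0 \<le> hoelder"
  using \<gamma> M_nonneg K(1) r(1) by (simp add: hoelder_def)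

lemma hoelder_estimate_ordered:
  assumes "0 \<le> a" "a < b" "b \<le> \<tau>"
  shows "norm (T b (R y) - T a (R y)) \<le> hoelder * \<tau> powr \<gamma> * norm y"
proof (cases "\<gamma> = 0")
  case True
  have "norm (T b (R y) - T a (R y)) \<le> M * norm (R y) + M * norm (R y)"
    using assms by (intro order_trans[OF norm_triangle_ineq4 add_mono] bound) auto
  also have "\<dots> \<le> 2 * M * (r * norm y)"
    using mult_left_mono[OF r(2) M_nonneg, of y] by simp
  finally show ?thesis unfolding hoelder_def using True assms by simp
next
  case False
  then have g: "0 < \<gamma>" using \<gamma> by simp
  have "norm (T b (R y) - T a (R y)) \<le> K / \<gamma> * b powr \<gamma> * norm y - K / \<gamma> * a powr \<gamma> * norm y"
  proof (rule differentiable_bound_general[OF assms(2)])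
    show "continuous_on {a..b} (\<lambda>t. T t (R y))"
      using assms by (intro continuous_on_subset[OF cont]) auto
    show "continuous_on {a..b} (\<lambda>t. K / \<gamma> * t powr \<gamma> * norm y)"
      using g assms by (intro continuous_intros continuous_on_powr') auto
    fix t assume "a < t" "t < b"
    then have t: "0 < t" using assms by simp
    show "((\<lambda>t. T t (R y)) has_vector_derivative A (T t (R y))) (at t)"
      by (rule smooth_derivative[OF t])
    show "((\<lambda>t. K / \<gamma> * t powr \<gamma> * norm y) has_vector_derivative K * t powr (\<gamma> - 1) * norm y) (at t)"
      using g t by (auto intro!: derivative_eq_intros simp flip: has_real_derivative_iff_has_vector_derivative)
    show "norm (A (T t (R y))) \<le> K * t powr (\<gamma> - 1) * norm y"
      by (rule K(2)[OF t])
  qed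
  also have "\<dots> \<le> K / \<gamma> * b powr \<gamma> * norm y"
    using g K(1) by simp
  also have "\<dots> \<le> K / \<gamma> * \<tau> powr \<gamma> * norm y"
    using g K(1) assms by (intro mult_right_mono mult_left_mono powr_mono2) auto
  finally show ?thesis using False by (simp add: hoelder_def)
qed

lemma hoelder_estimate:
  assumes "a \<in> {0..\<tau>}" "b \<in> {0..\<tau>}"
  shows "norm (T b (R y) - T a (R y)) \<le> hoelder * \<tau> powr \<gamma> * norm y"
proof -
  consider "a < b" | "b < a" | "a = b" by linarith
  then show ?thesis
    using hoelder_estimate_ordered[of a b \<tau> y] hoelder_estimate_ordered[of b a \<tau> y] assms hoelder_nonneg
    by cases (auto simp: norm_minus_commute)
qed

text \<open>The second derivative is not integrably controlled up to the endpoint, so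
  \<open>G s\<close> is merely compared with \<open>G m\<close>: the change of \<open>S\<close> is
  of order \<tau>, that of the analytic semigroup of order \<open>\<tau> powr \<gamma>\<close>, and
  the interval length supplies one more factor \<tau>.\<close>

lemma endpoint_step:
  assumes z: "z \<in> DB" and \<tau>: "0 < \<tau>" "\<tau> \<le> t0"
    and N: "0 \<le> N" "\<And>s x. 0 \<le> s \<Longrightarrow> s \<le> t0 \<Longrightarrow> norm (S s x) \<le> N * norm x"
  shows "norm (integral {0..\<tau>} (\<lambda>s. T (\<tau> - s) (R (S s z))) - \<tau> *\<^sub>R T (\<tau> - \<tau> / 2) (R (S (\<tau> / 2) z)))
    \<le> (M * r * t0 powr (1 - \<gamma>) + hoelder) * N * \<tau> powr (1 + \<gamma>) * (norm z + norm (B z))"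
proof -
  define m where "m = \<tau> / 2"
  have m: "m \<in> {0..\<tau>}" "\<tau> - m = m" using \<tau> by (auto simp: m_def)
  define G where "G = (\<lambda>s. T (\<tau> - s) (R (S s z)))"
  define E where "E = M * (r * (N * norm (B z) * \<tau>)) + hoelder * \<tau> powr \<gamma> * (N * norm z)"
  have GE: "norm (G s - G m) \<le> E" if s: "s \<in> {0..\<tau>}" for s
  proof -
    have "norm (S s z - S m z) \<le> N * norm (B z) * norm (s - m)"
    proof (rule differentiable_bound[of "{0..\<tau>}" _ "\<lambda>s h. h *\<^sub>R S s (B z)"])
      fix x assume x: "x \<in> {0..\<tau>}"
      show "((\<lambda>s. S s z) has_derivative (\<lambda>h. h *\<^sub>R S x (B z))) (at x within {0..\<tau>})"
        using has_vector_derivative_within_subset[OF Y.orbit_derivative[OF z, of x], of "{0..\<tau>}"] x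
        by (auto simp: has_vector_derivative_def)
      show "onorm (\<lambda>h. h *\<^sub>R S x (B z)) \<le> N * norm (B z)"
        using N(2)[of x "B z"] x \<tau>
        by (intro onorm_le) (auto simp: mult.commute[of _ "\<bar>_\<bar>"] intro!: mult_left_mono)
    qed (use s m in auto)
    also have "\<dots> \<le> N * norm (B z) * \<tau>"
      using s m N(1) by (intro mult_left_mono) auto
    finally have S: "norm (S s z - S m z) \<le> N * norm (B z) * \<tau>" .
    \<comment> \<open>Freezing the orbit of \<open>S\<close> at the midpoint leaves a fixed vector
      for the Hoelder estimate, while the increment of \<open>S\<close> only meets a bounded
      operator.\<close>
    have "G s - G m = T (\<tau> - s) (R (S s z - S m z)) + (T (\<tau> - s) (R (S m z)) - T (\<tau> - m) (R (S m z)))"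
      using s by (simp add: G_def linear_simps[OF R] linear_simps[OF bl])
    also have "norm \<dots> \<le> M * (r * (N * norm (B z) * \<tau>)) + hoelder * \<tau> powr \<gamma> * (N * norm z)"
    proof (rule order_trans[OF norm_triangle_ineq add_mono])
      show "norm (T (\<tau> - s) (R (S s z - S m z))) \<le> M * (r * (N * norm (B z) * \<tau>))"
        using s M_nonneg r(1) S
        by (intro order_trans[OF bound] mult_left_mono order_trans[OF r(2)]) auto
      have "norm (T (\<tau> - s) (R (S m z)) - T (\<tau> - m) (R (S m z))) \<le> hoelder * \<tau> powr \<gamma> * norm (S m z)"
        using s m by (intro hoelder_estimate) auto
      also have "\<dots> \<le> hoelder * \<tau> powr \<gamma> * (N * norm z)"
        using m \<tau> hoelder_nonneg by (intro mult_left_mono N(2)) auto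
      finally show "norm (T (\<tau> - s) (R (S m z)) - T (\<tau> - m) (R (S m z))) \<le> hoelder * \<tau> powr \<gamma> * (N * norm z)" .
    qed
    finally show ?thesis by (simp add: E_def)
  qed
  have "continuous_on {0..\<tau>} (\<lambda>s. R (S s z))"
    by (intro bounded_linear.continuous_on[OF R] continuous_on_subset[OF Y.cont]) auto
  then have cG: "continuous_on {0..\<tau>} G"
    unfolding G_def by (rule convolution_continuous)
  have "(G has_integral integral {0..\<tau>} G) {0..\<tau>}"
    using cG by (intro integrable_integral integrable_continuous_real)
  from has_integral_diff[OF this has_integral_const_real[of "G m" 0 \<tau>]]
  have "integral {0..\<tau>} (\<lambda>s. G s - G m) = integral {0..\<tau>} G - \<tau> *\<^sub>R G m"
    using \<tau> by (simp add: integral_unique)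
  moreover have "norm (integral {0..\<tau>} (\<lambda>s. G s - G m)) \<le> E * (\<tau> - 0)"
    using \<tau> GE by (intro integral_bound continuous_intros cG) auto
  moreover have "E * (\<tau> - 0) \<le> (M * r * t0 powr (1 - \<gamma>) + hoelder) * N * \<tau> powr (1 + \<gamma>) * (norm z + norm (B z))"
  proof -
    \<comment> \<open>The excess power \<open>1 - \<gamma>\<close> of \<tau> is absorbed into the
      constant through \<open>t0\<close>.\<close>
    have "\<tau> * \<tau> = \<tau> powr (1 + \<gamma>) * \<tau> powr (1 - \<gamma>)"
      using \<tau> by (simp add: powr_diff powr_add)
    also have "\<dots> \<le> \<tau> powr (1 + \<gamma>) * t0 powr (1 - \<gamma>)"
      using \<tau> \<gamma> by (intro mult_left_mono powr_mono2) auto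
    finally have tt: "\<tau> * \<tau> \<le> \<tau> powr (1 + \<gamma>) * t0 powr (1 - \<gamma>)" .
    have "E * (\<tau> - 0) = M * r * N * norm (B z) * (\<tau> * \<tau>) + hoelder * N * norm z * (\<tau> powr \<gamma> * \<tau>)"
      by (simp add: E_def algebra_simps)
    also have "\<dots> \<le> M * r * N * norm (B z) * (\<tau> powr (1 + \<gamma>) * t0 powr (1 - \<gamma>)) + hoelder * N * norm z * \<tau> powr (1 + \<gamma>)"
      using tt M_nonneg r(1) N(1) \<tau> hoelder_nonneg
      by (intro add_mono mult_left_mono) (auto simp: powr_add mult.commute)
    also have "\<dots> = (M * r * t0 powr (1 - \<gamma>)) * N * \<tau> powr (1 + \<gamma>) * norm (B z) + hoelder * N * \<tau> powr (1 + \<gamma>) * norm z"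
      by (simp add: algebra_simps)
    also have "\<dots> \<le> (M * r * t0 powr (1 - \<gamma>)) * N * \<tau> powr (1 + \<gamma>) * (norm z + norm (B z))
        + hoelder * N * \<tau> powr (1 + \<gamma>) * (norm z + norm (B z))"
      using M_nonneg r(1) N(1) hoelder_nonneg by (intro add_mono mult_left_mono) auto
    finally show ?thesis by (simp add: algebra_simps)
  qed
  ultimately show ?thesis by (simp add: G_def m_def)
qed

end

section \<open>Accumulation of the local errors\<close>

context coupled_semigroups
begin

text \<open>The splitting sum is exactly the negative of a composite midpoint rule, so adding the
  integral leaves only local quadrature errors. At \<open>n = 1\<close> the right-hand side is 0
  because \<open>ln 1 = 0\<close>; the bound starts at \<open>n = 2\<close>, where the logarithm can
  absorb additive constants.\<close>

lemma strang_splitting_error: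
  "\<exists>C\<ge>0. \<forall>n::nat. n \<ge> 2 \<longrightarrow> (\<forall>y. y \<in> DB \<and> B y \<in> DB \<and> B (B y) \<in> DB \<longrightarrow>
    (\<forall>t. 0 < t \<and> t \<le> t0 \<longrightarrow>
      norm (Vn_str T S R B n (t / real n) y + integral {0..t} (\<lambda>s. T (t - s) (R (S s (B y)))))
      \<le> C * (t powr (1 + \<gamma>) * ln (real n) / real n powr (1 + \<gamma>))
          * (norm (B y) + norm (B (B y)) + norm (B (B (B y))))))"
proof -
  obtain N where N: "0 \<le> N" "\<And>s x. 0 \<le> s \<Longrightarrow> s \<le> t0 \<Longrightarrow> norm (S s x) \<le> N * norm x"
    by (rule Y.locally_bounded[of t0]) (rule that)
  \<comment> \<open>The sign of \<open>t0\<close> is unrestricted here; the absolute value keeps the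
    constant nonnegative, and the real powers are nonnegative anyway.\<close>
  define Ci where "Ci = (4 * M * K + 2 * K * \<bar>t0\<bar> + M * r * t0 powr (2 - \<gamma>)) * N"
  define Ce where "Ce = (M * r * t0 powr (1 - \<gamma>) + hoelder) * N"
  have Ci: "0 \<le> Ci" and Ce: "0 \<le> Ce"
    using M_nonneg K(1) r(1) N(1) hoelder_nonneg by (simp_all add: Ci_def Ce_def)
  have "norm (Vn_str T S R B n (t / real n) y + integral {0..t} (\<lambda>s. T (t - s) (R (S s (B y)))))
      \<le> 4 * (Ci + Ce) * N * (t powr (1 + \<gamma>) * ln (real n) / real n powr (1 + \<gamma>))
          * (norm (B y) + norm (B (B y)) + norm (B (B (B y))))"
    if n: "n \<ge> 2" and y: "y \<in> DB" "B y \<in> DB" "B (B y) \<in> DB" and t: "0 < t" "t \<le> t0" for n :: nat and y t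
  proof -
    define \<tau> where "\<tau> = t / real n"
    have \<tau>: "0 < \<tau>" "real n * \<tau> = t" using t n by (simp_all add: \<tau>_def)
    have le: "real j * \<tau> \<le> t0" if "j \<le> n" for j
      using mult_right_mono[of "real j" "real n" \<tau>] that \<tau> t by simp
    have \<tau>0: "\<tau> \<le> t0" using le[of 1] n by simp
    define z where "z = (\<lambda>j. S (real j * \<tau>) (B y))"
    define Z where "Z = norm (B y) + norm (B (B y)) + norm (B (B (B y)))"
    define f where "f = (\<lambda>s. T (t - s) (R (S s (B y))))"
    define E where "E = (\<lambda>j. integral {0..\<tau>} (\<lambda>s. f (real j * \<tau> + s))
      - \<tau> *\<^sub>R T (real (n - 1 - j) * \<tau> + \<tau> / 2) (R (S (\<tau> / 2) (z j))))"
    have E: "norm (E j) \<le> (Ci + Ce) * \<tau> powr (1 + \<gamma>) * (N * Z) * (1 / real (max 1 (n - Suc j)))"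
      if j: "j < n" for j
    proof -
      \<comment> \<open>The number of whole steps left after step \<open>j\<close>; as
        \<open>j < n\<close>, the natural subtraction is exact.\<close>
      define k where "k = real (n - Suc j)"
      have k: "k + 1 + real j = real n" using j by (simp add: k_def)
      have j0: "0 \<le> real j * \<tau>" "real j * \<tau> \<le> t0" using \<tau> le j by auto
      note gs = Y.generator_semigroup[OF _ j0(1)]
      have zD: "z j \<in> DB" "B (z j) \<in> DB" and Bz: "B (z j) = S (real j * \<tau>) (B (B y))"
        "B (B (z j)) = S (real j * \<tau>) (B (B (B y)))"
        unfolding z_def using gs y by auto
      have zZ: "norm (z j) + norm (B (z j)) + norm (B (B (z j))) \<le> N * Z"
        unfolding Bz(2) unfolding Bz(1) unfolding z_def Z_def distrib_left using j0 by (intro add_mono N(2))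
      have "t = (k + 1) * \<tau> + real j * \<tau>"
        using \<tau>(2) by (simp add: k[symmetric] algebra_simps)
      then have ft: "f (real j * \<tau> + s) = T ((k + 1) * \<tau> - s) (R (S s (z j)))" if "s \<in> {0..\<tau>}" for s
        using that \<tau> by (simp add: f_def z_def flip: Y.T_add) (simp add: algebra_simps)
      then have fi: "integral {0..\<tau>} (\<lambda>s. f (real j * \<tau> + s)) = integral {0..\<tau>} (\<lambda>s. T ((k + 1) * \<tau> - s) (R (S s (z j))))"
        by (intro integral_cong)
      have Ej: "E j = integral {0..\<tau>} (\<lambda>s. T ((k + 1) * \<tau> - s) (R (S s (z j))))
          - \<tau> *\<^sub>R T ((k + 1) * \<tau> - \<tau> / 2) (R (S (\<tau> / 2) (z j)))"
        unfolding E_def fi by (simp add: k_def algebra_simps)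
      show ?thesis
      proof (cases "n - Suc j = 0")
        case True
        then have "k = 0" by (simp add: k_def)
        then have "norm (E j) \<le> Ce * \<tau> powr (1 + \<gamma>) * (norm (z j) + norm (B (z j)))"
          using endpoint_step[OF zD(1) \<tau>(1) \<tau>0 N] by (simp add: Ej Ce_def)
        also have "\<dots> \<le> (Ci + Ce) * \<tau> powr (1 + \<gamma>) * (N * Z)"
          using order_trans[OF _ zZ, of "norm (z j) + norm (B (z j))"] Ci Ce by (intro mult_mono) auto
        finally show ?thesis using True by simp
      next
        case False
        then have k1: "1 \<le> k" by (simp add: k_def)
        have "k * \<tau> \<le> t0" using le[of "n - Suc j"] by (simp add: k_def)
        from interior_step[OF zD \<tau>(1) k1 this \<tau>0 N]
        have "norm (E j) \<le> Ci * (\<tau> powr (1 + \<gamma>) / k) * (norm (z j) + norm (B (z j)) + norm (B (B (z j))))"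
          using \<tau> \<tau>0 by (simp add: Ej Ci_def)
        also have "\<dots> \<le> (Ci + Ce) * (\<tau> powr (1 + \<gamma>) / k) * (N * Z)"
          using zZ Ci Ce k1 by (intro mult_mono) auto
        finally have "norm (E j) \<le> (Ci + Ce) * (\<tau> powr (1 + \<gamma>) / k) * (N * Z)" .
        moreover have "max 1 (n - Suc j) = n - Suc j" using False by linarith
        ultimately show ?thesis unfolding k_def by simp
      qed
    qed
    have "continuous_on {0..t} (\<lambda>s. R (S s (B y)))"
      by (intro bounded_linear.continuous_on[OF R] continuous_on_subset[OF Y.cont]) auto
    then have "continuous_on {0..t} f"
      unfolding f_def by (rule convolution_continuous)
    then have int: "integral {0..t} f = (\<Sum>j<n. integral {0..\<tau>} (\<lambda>s. f (real j * \<tau> + s)))"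
      using integral_equal_pieces[of \<tau> n f] \<tau> by simp
    \<comment> \<open>\<open>B\<close> commutes with \<open>S\<close> on its domain, and the half
      step joins the remaining \<open>n - 1 - j\<close> full steps by the semigroup law. This
      produces the midpoint value of the integrand.\<close>
    have V: "Vn_str T S R B n \<tau> y
        = (\<Sum>j<n. - (\<tau> *\<^sub>R T (real (n - 1 - j) * \<tau> + \<tau> / 2) (R (S (\<tau> / 2) (z j)))))"
      unfolding Vn_str_def
    proof (rule sum.cong[OF refl])
      fix j
      have "0 \<le> real j * \<tau>" "0 \<le> real (n - 1 - j) * \<tau>" "0 \<le> \<tau> / 2" using \<tau> by auto
      then show "T (real (n - 1 - j) * \<tau>) (V_str T S R B \<tau> (S (real j * \<tau>) y))
          = - (\<tau> *\<^sub>R T (real (n - 1 - j) * \<tau> + \<tau> / 2) (R (S (\<tau> / 2) (z j))))"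
        using y(1) by (simp add: V_str_def z_def Y.generator_semigroup T_add linear_simps[OF bl])
    qed
    have "Vn_str T S R B n \<tau> y + integral {0..t} f = (\<Sum>j<n. E j)"
      by (simp add: V int E_def sum_subtractf sum_negf)
    also have "norm \<dots> \<le> (\<Sum>j<n. (Ci + Ce) * \<tau> powr (1 + \<gamma>) * (N * Z) * (1 / real (max 1 (n - Suc j))))"
      using E by (intro sum_norm_le) auto
    \<comment> \<open>Reversing the order of summation replaces \<open>n - Suc j\<close> by
      \<open>k\<close>.\<close>
    also have "\<dots> = (Ci + Ce) * \<tau> powr (1 + \<gamma>) * (N * Z) * (\<Sum>k<n. 1 / real (max 1 k))"
      by (simp only: sum_distrib_left[symmetric] sum.nat_diff_reindex[of "\<lambda>k. 1 / real (max 1 k)"])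
    also have "\<dots> \<le> (Ci + Ce) * \<tau> powr (1 + \<gamma>) * (N * Z) * (4 * ln (real n))"
      using Ci Ce N(1) by (intro mult_left_mono sum_inverse_le_ln n) (auto simp: Z_def)
    also have "\<dots> = 4 * (Ci + Ce) * N * (t powr (1 + \<gamma>) * ln (real n) / real n powr (1 + \<gamma>)) * Z"
      using t by (simp add: \<tau>_def powr_divide)
    finally show ?thesis by (simp add: \<tau>_def f_def Z_def)
  qed
  then show ?thesis
    using Ci Ce N(1) by (intro exI[of _ "4 * (Ci + Ce) * N"]) simp
qed

end

section \<open>The boundary operator and the theorem\<close>

theorem theorem4p11:
  fixes JE :: "'e::banach \<Rightarrow> 'e" and JF :: "'f::banach \<Rightarrow> 'f"
    and Am :: "'e \<Rightarrow> 'e" and domAm :: "'e set"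
    and B :: "'f \<Rightarrow> 'f" and domB :: "'f set"
    and L :: "'e \<Rightarrow> 'f"
    and T0 :: "real \<Rightarrow> 'e \<Rightarrow> 'e" and S :: "real \<Rightarrow> 'f \<Rightarrow> 'f"
    and \<gamma> :: real
  defines "domA0 \<equiv> domAm \<inter> {x. L x = 0}"
    and "D0 \<equiv> inv_into (domAm \<inter> {x. Am x = 0}) L"
  assumes JE: "cstruct JE" and JF: "cstruct JF"
    and Am_lin: "clin_op JE JE domAm Am"
    and B_lin: "clin_op JF JF domB B"
    and L_lin: "clin_op JE JF domAm L"
    and L_surj: "L ` domAm = UNIV"
    and L_bdd: "\<exists>c. \<forall>x\<in>domAm. norm (L x) \<le> c * (norm x + norm (Am x))"
    and A0_gen: "generates domA0 Am T0"
    and T0_analytic: "bounded_analytic_sg JE T0"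
    and B_gen: "generates domB B S"
    and closed_graph: "closed ((\<lambda>x. (x, Am x, L x)) ` domAm)"
    and A0_inv: "bdd_invertible domA0 Am"
    and B_inv: "bdd_invertible domB B"
    and Q_ext: "\<exists>Q :: real \<Rightarrow> 'f \<Rightarrow> 'e.
        (\<forall>t\<ge>0. bounded_linear (Q t) \<and>
           (\<forall>y\<in>domB. Q t y = D0 (S t y) - T0 t (D0 y)
               - integral {0..t} (\<lambda>s. T0 (t - s) (D0 (S s (B y)))))) \<and>
        (\<exists>M \<delta>. 0 < \<delta> \<and> (\<forall>t. 0 < t \<and> t < \<delta> \<longrightarrow> onorm (Q t) \<le> M))"
    and \<gamma>: "0 \<le> \<gamma>" "\<gamma> \<le> 1"
    and D0_range: "range D0 \<subseteq> frac_dom domA0 Am \<gamma>"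
  shows "\<forall>tmax>0. \<exists>C\<ge>0. \<forall>n::nat. n \<ge> 2 \<longrightarrow>
           (\<forall>y. y \<in> domB \<and> B y \<in> domB \<and> B (B y) \<in> domB \<longrightarrow>
             (\<forall>t. 0 < t \<and> t \<le> tmax \<longrightarrow>
               norm (Vn_str T0 S D0 B n (t / real n) y
                     + integral {0..t} (\<lambda>s. T0 (t - s) (D0 (S s (B y)))))
               \<le> C * (t powr (1 + \<gamma>) * ln (real n) / real n powr (1 + \<gamma>))
                   * (norm (B y) + norm (B (B y)) + norm (B (B (B y))))))"
proof -
  interpret G: semigroup_generator domA0 Am T0 by unfold_locales (rule A0_gen)
  have limit: "x \<in> domAm \<and> Am x = a \<and> L x = l"
    if "\<And>n::nat. u n \<in> domAm" "u \<longlonglongrightarrow> x" "(\<lambda>n. Am (u n)) \<longlonglongrightarrow> a" "(\<lambda>n. L (u n)) \<longlonglongrightarrow> l" for u x a l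
  proof -
    have "(\<lambda>n. (u n, Am (u n), L (u n))) \<longlonglongrightarrow> (x, a, l)"
      using that by (intro tendsto_Pair)
    then have "(x, a, l) \<in> (\<lambda>x. (x, Am x, L x)) ` domAm"
      by (rule closed_sequentially[OF closed_graph, rotated]) (use that(1) in auto)
    then show ?thesis by auto
  qed
  obtain M where M: "0 \<le> M" "\<And>t x. 0 \<le> t \<Longrightarrow> norm (T0 t x) \<le> M * norm x"
    "\<And>t x. 0 < t \<Longrightarrow> T0 t x \<in> domA0" "\<And>t x. 0 < t \<Longrightarrow> t * norm (Am (T0 t x)) \<le> M * norm x"
    by (rule G.analytic_estimate[OF JE T0_analytic]) (rule that)
  interpret G: analytic_semigroup_generator domA0 Am T0 M
  proof
    fix u :: "nat \<Rightarrow> 'e" and x y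
    assume u: "\<And>n. u n \<in> domA0" "u \<longlonglongrightarrow> x" "(\<lambda>n. Am (u n)) \<longlonglongrightarrow> y"
    \<comment> \<open>On \<open>domA0\<close> the third component of the closed graph is constantly
      0, so closedness of the pair gives closedness of the generator.\<close>
    then have "(\<lambda>n. L (u n)) \<longlonglongrightarrow> 0" by (simp add: domA0_def)
    then show "x \<in> domA0 \<and> Am x = y"
      using limit[of u x y 0] u by (auto simp: domA0_def)
  qed (use M in auto)
  have lin: "subspace domAm"
    "\<And>x y. x \<in> domAm \<Longrightarrow> y \<in> domAm \<Longrightarrow> Am (x + y) = Am x + Am y"
    "\<And>x y. x \<in> domAm \<Longrightarrow> y \<in> domAm \<Longrightarrow> L (x + y) = L x + L y"
    "\<And>x c. x \<in> domAm \<Longrightarrow> Am (c *\<^sub>R x) = c *\<^sub>R Am x"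
    "\<And>x c. x \<in> domAm \<Longrightarrow> L (c *\<^sub>R x) = c *\<^sub>R L x"
    using Am_lin L_lin by (auto simp: clin_op_def)
  have diff: "x - y \<in> domAm" "Am (x - y) = Am x - Am y" "L (x - y) = L x - L y"
    if "x \<in> domAm" "y \<in> domAm" for x y
    using lin(2,3)[of x "- 1 *\<^sub>R y"] lin(4,5)[of y "- 1"] that subspace_diff[OF lin(1)]
      subspace_scale[OF lin(1), of y "- 1"] by auto
  have "L ` (domAm \<inter> {x. Am x = 0}) = UNIV"
  proof (safe; simp)
    fix y
    obtain x where x: "x \<in> domAm" "L x = y" using L_surj by (metis UNIV_I imageE)
    \<comment> \<open>Subtracting the element of \<open>ker L\<close> with the same image under
      \<open>Am\<close> moves \<open>x\<close> into \<open>ker Am\<close> without changing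
      \<open>L x\<close>.\<close>
    obtain x0 where x0: "x0 \<in> domA0" "Am x0 = Am x"
      using A0_inv by (metis UNIV_I bdd_invertible_def bij_betw_imp_surj_on imageE)
    have "x - x0 \<in> domAm \<inter> {x. Am x = 0}" "L (x - x0) = y"
      using x x0 diff[of x x0] by (auto simp: domA0_def)
    then show "y \<in> L ` (domAm \<inter> {x. Am x = 0})" by blast
  qed
  then have D0: "D0 y \<in> domAm" "Am (D0 y) = 0" "L (D0 y) = y" for y
    using inv_into_into[of y L "domAm \<inter> {x. Am x = 0}"] f_inv_into_f[of y L "domAm \<inter> {x. Am x = 0}"]
    by (auto simp: D0_def)
  \<comment> \<open>Two candidates differ by an element of \<open>domA0\<close> that
    \<open>Am\<close> annihilates, and \<open>Am\<close> is injective there. This turns the choice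
    in \<open>inv_into\<close> into a characterisation from which linearity and the closed graph
    follow.\<close>
  have D0_unique: "D0 y = x" if x: "x \<in> domAm" "Am x = 0" "L x = y" for x y
  proof -
    have "D0 y - x \<in> domA0" "Am (D0 y - x) = Am 0" "(0::'e) \<in> domA0"
      using diff[OF D0(1) x(1), of y] D0 x subspace_0[OF lin(1)] lin(4,5)[of 0 0] by (auto simp: domA0_def)
    then have "D0 y - x = 0"
      using A0_inv by (metis bdd_invertible_def bij_betw_imp_inj_on inj_onD)
    then show ?thesis by simp
  qed
  have D0_bl: "bounded_linear D0"
  proof (rule closed_graph_bounded_linear)
    show "linear D0"
      by (intro linearI D0_unique) (auto simp: D0 lin subspace_add subspace_scale)
    fix u y x assume u: "u \<longlonglongrightarrow> y" "(\<lambda>n. D0 (u n)) \<longlonglongrightarrow> x"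
    then have "x \<in> domAm \<and> Am x = 0 \<and> L x = y"
      by (intro limit[of "\<lambda>n. D0 (u n)"]) (simp_all add: D0)
    then show "D0 y = x" by (intro D0_unique) auto
  qed
  obtain r where r: "0 \<le> r" "\<And>y. norm (D0 y) \<le> r * norm y"
    using bounded_linear.nonneg_bounded[OF D0_bl] by (metis mult.commute)
  obtain K where K: "0 \<le> K" "\<And>t y. 0 < t \<Longrightarrow> norm (Am (T0 t (D0 y))) \<le> K * t powr (\<gamma> - 1) * norm y"
    by (rule G.frac_range_estimate[OF \<gamma> D0_bl D0_range]) (rule that)
  interpret coupled_semigroups domA0 Am T0 M domB B S D0 \<gamma> K r
  proof (intro coupled_semigroups.intro coupled_semigroups_axioms.intro)
    show "analytic_semigroup_generator domA0 Am T0 M" by (rule G.analytic_semigroup_generator_axioms)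
    show "semigroup_generator domB B S" by unfold_locales (rule B_gen)
  qed (rule \<gamma> D0_bl r K | assumption)+
  show ?thesis using strang_splitting_error by blast
qed

end
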